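(* The maximum size of a set of mutually orthogoval projective planes of order $q$ (each isomorphic to $\mathrm{PG}(2,q)$), all on a common point set, is $2$ for $q\in\{2,4,5\}$ and is $4$ for $q=3$.
   Context: Two planes, both projective or both affine, of the same order and on the same point set are called orthogoval if every line of one plane intersects every line of the other plane in at most two points. A set of planes is a set of mutually orthogoval planes if the planes are pairwise orthogoval. *)

theory Defs
  imports "HOL-Algebra.Ring" "HOL-Algebra.Coset"
begin

text \<open>A plane is given by its point set and its set of lines, each line being the set of its points.\<close>

locale projective_plane =
  fixes points :: "'a set" and lines :: "'a set set" and q :: nat
  assumes order_ge_2: "q \<ge> 2"
    and lines_subset: "l \<in> lines \<Longrightarrow> l \<subseteq> points"
    and unique_line:
      "\<lbrakk>x \<in> points; y \<in> points; x \<noteq> y\<rbrakk> \<Longrightarrow> \<exists>!l. l \<in> lines \<and> x \<in> l \<and> y \<in> l"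
    and unique_point:
      "\<lbrakk>l \<in> lines; m \<in> lines; l \<noteq> m\<rbrakk> \<Longrightarrow> \<exists>!x. x \<in> points \<and> x \<in> l \<and> x \<in> m"
    and quadrangle:
      "\<exists>A. A \<subseteq> points \<and> card A = 4 \<and> (\<forall>l\<in>lines. finite (A \<inter> l) \<and> card (A \<inter> l) \<le> 2)"
    and card_line: "l \<in> lines \<Longrightarrow> card l = q + 1"

definition planes_isomorphic ::
    "'a set \<Rightarrow> 'a set set \<Rightarrow> 'b set \<Rightarrow> 'b set set \<Rightarrow> bool" where
  "planes_isomorphic P L P' L' \<longleftrightarrow> (\<exists>f. bij_betw f P P' \<and> (\<lambda>l. f ` l) ` L = L')"

text \<open>The Desarguesian plane over a field \<open>F\<close>: points are the one-dimensional subspaces of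
  \<open>F\<^sup>3\<close>, and a line consists of the points satisfying a nonzero homogeneous linear equation
  \<open>a x + b y + c z = 0\<close>.\<close>

definition nonzero_triples :: "('k, 'm) ring_scheme \<Rightarrow> ('k \<times> 'k \<times> 'k) set" where
  "nonzero_triples F =
     (carrier F \<times> carrier F \<times> carrier F) - {(\<zero>\<^bsub>F\<^esub>, \<zero>\<^bsub>F\<^esub>, \<zero>\<^bsub>F\<^esub>)}"

definition span1 :: "('k, 'm) ring_scheme \<Rightarrow> 'k \<times> 'k \<times> 'k \<Rightarrow> ('k \<times> 'k \<times> 'k) set" where
  "span1 F v = (case v of (x, y, z) \<Rightarrow>
     {(c \<otimes>\<^bsub>F\<^esub> x, c \<otimes>\<^bsub>F\<^esub> y, c \<otimes>\<^bsub>F\<^esub> z) | c. c \<in> carrier F})"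

definition PG2_points :: "('k, 'm) ring_scheme \<Rightarrow> ('k \<times> 'k \<times> 'k) set set" where
  "PG2_points F = span1 F ` nonzero_triples F"

definition PG2_line ::
    "('k, 'm) ring_scheme \<Rightarrow> 'k \<times> 'k \<times> 'k \<Rightarrow> ('k \<times> 'k \<times> 'k) set set" where
  "PG2_line F w = (case w of (a, b, c) \<Rightarrow>
     {span1 F (x, y, z) | x y z. (x, y, z) \<in> nonzero_triples F \<and>
        a \<otimes>\<^bsub>F\<^esub> x \<oplus>\<^bsub>F\<^esub> b \<otimes>\<^bsub>F\<^esub> y \<oplus>\<^bsub>F\<^esub> c \<otimes>\<^bsub>F\<^esub> z = \<zero>\<^bsub>F\<^esub>})"

definition PG2_lines :: "('k, 'm) ring_scheme \<Rightarrow> ('k \<times> 'k \<times> 'k) set set set" where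
  "PG2_lines F = PG2_line F ` nonzero_triples F"

text \<open>The plane \<open>PG(2,q)\<close> is the plane over the field with \<open>q\<close> elements. That field is finite, so
  realising it on a set of natural numbers is no restriction; it is unique up to isomorphism, so
  the choice of \<open>F\<close> is immaterial. For \<open>q = 0\<close>, which \<open>order\<close> also assigns to infinite fields,
  this predicate is not meaningful.\<close>

definition isomorphic_to_PG2 :: "nat \<Rightarrow> 'a set \<Rightarrow> 'a set set \<Rightarrow> bool" where
  "isomorphic_to_PG2 q P L \<longleftrightarrow>
     (\<exists>F :: nat ring. field F \<and> order F = q \<and>
        planes_isomorphic P L (PG2_points F) (PG2_lines F))"

text \<open>Orthogovality of two planes on the same point set, given by their sets of lines.\<close>

definition orthogoval :: "'a set set \<Rightarrow> 'a set set \<Rightarrow> bool" where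
  "orthogoval L M \<longleftrightarrow> (\<forall>l\<in>L. \<forall>m\<in>M. finite (l \<inter> m) \<and> card (l \<inter> m) \<le> 2)"

definition mutually_orthogoval_PG2 :: "nat \<Rightarrow> 'a set \<Rightarrow> 'a set set set \<Rightarrow> bool" where
  "mutually_orthogoval_PG2 q P S \<longleftrightarrow>
     (\<forall>L\<in>S. projective_plane P L q \<and> isomorphic_to_PG2 q P L) \<and> pairwise orthogoval S"

text \<open>Finiteness is stated explicitly because \<open>card\<close> of an infinite set is \<open>0\<close>.\<close>

definition is_max_size_orthogoval_PG2 :: "nat \<Rightarrow> 'a set \<Rightarrow> nat \<Rightarrow> bool" where
  "is_max_size_orthogoval_PG2 q P n \<longleftrightarrow>
     (\<exists>S. mutually_orthogoval_PG2 q P S \<and> finite S \<and> card S = n) \<and>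
     (\<forall>S. mutually_orthogoval_PG2 q P S \<longrightarrow> finite S \<and> card S \<le> n)"

end

theory Submission
  imports Defs "HOL-Algebra.Multiplicative_Group" "HOL-Computational_Algebra.Primes"
begin

text \<open>Lower bounds are by explicit witnesses. A permutation of the points of PG(2,q) carries
  the plane to another copy of it on the same points. The permutations in \<open>tbs2\<close>,
  \<open>tbs4\<close> and \<open>tbs5\<close> give one further plane, those in \<open>tbs3\<close>
  give three, and \<open>planes2\<close> to \<open>planes5\<close> check the plane axioms and the
  pairwise intersections by evaluation. \<open>orthogoval_planes_exist\<close> transports these
  planes to any point set of the right size.

  Upper bounds are by exhaustive search. Suppose that n + 1 mutually orthogoval planes existed, n
  being the claimed maximum. One of them is taken as reference plane and given homogeneous
  coordinates. A line of any other plane has q + 1 points, at most two of them on a line of the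
  reference plane, so it is a (q+1)-arc there. For q = 2, 3, 4, 5 all (q+1)-arcs are projectively
  equivalent: three or four of the points go to a standard frame (\<open>three_point_frame\<close>,
  \<open>four_point_frame\<close>), and the few arcs through the frame are moved to one fixed arc m
  by explicit matrices (\<open>arc_normal_form\<close>, \<open>move2\<close> to
  \<open>move5\<close>). Hence the coordinates can be chosen so that m is a line of the second
  plane.

  The search rebuilds parts of the n other planes around m. Any two points of a plane are joined by
  a line; every line is an arc of the reference plane; two lines of one plane share at most one
  point, two lines of different planes at most two. Branching is over the arc that joins a point x
  to the first point not yet joined to it. If the planes existed, some branch would follow their
  lines to the end (\<open>gen_complete\<close>, \<open>search_complete\<close>,
  \<open>search_nonempty\<close>); but evaluation shows that no branch survives
  (\<open>search2\<close> to \<open>search5\<close>).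

  Two bridges connect this with the definitions. A field of order 2, 3, 4 or 5 is isomorphic to a
  concrete type (\<open>prime_field_iso\<close>, \<open>gf4_iso\<close>), so that by
  \<open>planes_isomorphic_iff_coordinates\<close> being a copy of PG(2,q) means having coordinates
  over that type. \<open>coordinates_code\<close> then replaces points by bit strings, on which the
  search runs.\<close>

section \<open>Executable search: point sets as tries, pencils of lines, generation of arcs\<close>

text \<open>A set of bit strings of one common length. Points are encoded by such strings, so that
  common points of two lines are counted by descending both tries in parallel.\<close>

datatype trie = Empty | Here | Node trie trie

fun mem :: "trie \<Rightarrow> bool list \<Rightarrow> bool" where
  "mem (Node a b) (False # p) = mem a p"
| "mem (Node a b) (True # p) = mem b p"
| "mem Here [] = True"
| "mem Empty p = False"
| "mem Here (c # p) = False"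
| "mem (Node a b) [] = False"

fun ins :: "bool list \<Rightarrow> trie \<Rightarrow> trie" where
  "ins [] t = Here"
| "ins (False # p) (Node a b) = Node (ins p a) b"
| "ins (True # p) (Node a b) = Node a (ins p b)"
| "ins (False # p) Empty = Node (ins p Empty) Empty"
| "ins (True # p) Empty = Node Empty (ins p Empty)"
| "ins (c # p) Here = Here"

fun mktrie :: "bool list list \<Rightarrow> trie" where
  "mktrie [] = Empty"
| "mktrie (p # ps) = ins p (mktrie ps)"

fun cnt :: "trie \<Rightarrow> trie \<Rightarrow> nat \<Rightarrow> nat" where
  "cnt (Node a b) (Node c d) n = cnt a c (cnt b d n)"
| "cnt Empty t n = n"
| "cnt Here Here n = Suc n"
| "cnt Here Empty n = n"
| "cnt (Node a b) Empty n = n"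
| "cnt Here (Node a b) n = n"
| "cnt (Node a b) Here n = n"

fun le1 :: "nat \<Rightarrow> bool" where
  "le1 0 = True" | "le1 (Suc 0) = True" | "le1 (Suc (Suc n)) = False"

fun le2 :: "nat \<Rightarrow> bool" where
  "le2 0 = True" | "le2 (Suc n) = le1 n"

fun keep :: "bool \<Rightarrow> 'a \<Rightarrow> 'a list \<Rightarrow> 'a list" where
  "keep True x xs = x # xs"
| "keep False x xs = xs"

fun outside :: "trie \<Rightarrow> bool list list \<Rightarrow> bool list list" where
  "outside m [] = []"
| "outside m (y # ys) = keep (\<not> mem m y) y (outside m ys)"

fun compats :: "trie \<Rightarrow> trie list \<Rightarrow> trie list" where
  "compats m [] = []"
| "compats m (t # ts) = keep (le1 (cnt m t 0)) t (compats m ts)"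

lemma length_keep: "length (keep b x xs) \<le> Suc (length xs)"
  by (cases b) auto

lemma length_outside: "length (outside m ys) \<le> length ys"
  by (induction ys) (auto intro: order_trans[OF length_keep])

text \<open>Backtracking in the manner of an exact cover: the first point still to be covered lies
  on some line, so the branching is over the candidates through it; the chosen line removes the
  points it covers and the candidates meeting it more than once. Tests are passed as a Boolean
  argument to separate functions such as \<open>pencil_branch\<close>, so that rewriting unfolds
  only the branch taken.\<close>

function (sequential) pencil :: "bool list list \<Rightarrow> trie list \<Rightarrow> trie list \<Rightarrow> trie list list"
  and pencil_choose :: "bool list \<Rightarrow> bool list list \<Rightarrow> trie list \<Rightarrow> trie list \<Rightarrow> trie list \<Rightarrow> trie list list"
  and pencil_branch :: "bool \<Rightarrow> bool list \<Rightarrow> bool list list \<Rightarrow> trie \<Rightarrow> trie list \<Rightarrow> trie list \<Rightarrow> trie list \<Rightarrow> trie list list"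
where
  "pencil [] T acc = [acc]"
| "pencil (y # ys) T acc = pencil_choose y ys T T acc"
| "pencil_choose y ys [] T acc = []"
| "pencil_choose y ys (m # ms) T acc = pencil_branch (mem m y) y ys m ms T acc"
| "pencil_branch True y ys m ms T acc =
     pencil (outside m ys) (compats m T) (m # acc) @ pencil_choose y ys ms T acc"
| "pencil_branch False y ys m ms T acc = pencil_choose y ys ms T acc"
  by pat_completeness auto
termination
  \<comment> \<open>Doubling the lengths leaves an odd value between \<open>pencil ys\<close> and
    \<open>pencil (y # ys)\<close> for the two auxiliary functions; among these the remaining
    candidates decide.\<close>
  by (relation "inv_image (less_than <*lex*> less_than) (\<lambda>z. case z of
        Inl (ys, _, _) \<Rightarrow> (2 * length ys, 0)
      | Inr (Inl (y, ys, ms, _, _)) \<Rightarrow> (Suc (2 * length ys), 2 * length ms)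
      | Inr (Inr (b, y, ys, m, ms, _, _)) \<Rightarrow> (Suc (2 * length ys), Suc (2 * length ms)))")
     (auto simp: le_imp_less_Suc length_outside)

fun uncovered :: "bool list \<Rightarrow> trie list \<Rightarrow> bool list list \<Rightarrow> bool list list"
  and uncovered_step :: "bool \<Rightarrow> trie \<Rightarrow> bool list list \<Rightarrow> bool list list"
where
  "uncovered x [] ys = ys"
| "uncovered x (t # ts) ys = uncovered_step (mem t x) t (uncovered x ts ys)"
| "uncovered_step True t ys = outside t ys"
| "uncovered_step False t ys = ys"

fun ok2 :: "trie \<Rightarrow> trie list \<Rightarrow> bool"
  and ok2_step :: "bool \<Rightarrow> trie \<Rightarrow> trie list \<Rightarrow> bool"
where
  "ok2 t [] = True"
| "ok2 t (k # K) = ok2_step (le2 (cnt t k 0)) t K"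
| "ok2_step True t K = ok2 t K"
| "ok2_step False t K = False"

fun ok1 :: "trie \<Rightarrow> trie list \<Rightarrow> trie list \<Rightarrow> bool"
  and ok1_step :: "bool \<Rightarrow> trie \<Rightarrow> trie list \<Rightarrow> trie list \<Rightarrow> bool"
where
  "ok1 t [] K = ok2 t K"
| "ok1 t (a # acc) K = ok1_step (le1 (cnt t a 0)) t acc K"
| "ok1_step True t acc K = ok1 t acc K"
| "ok1_step False t acc K = False"

fun admissible :: "trie list \<Rightarrow> trie list \<Rightarrow> trie list \<Rightarrow> trie list" where
  "admissible K acc [] = []"
| "admissible K acc (t # T) = keep (ok1 t acc K) t (admissible K acc T)"

text \<open>\<open>acc\<close> holds the known lines of the plane being extended, which a new line
  may meet in one point, and \<open>K\<close> the known lines of the other planes, which it may meet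
  in two.\<close>

fun stage :: "trie list \<Rightarrow> bool list list \<Rightarrow> trie list \<Rightarrow> trie list \<Rightarrow> trie list list" where
  "stage K [] T acc = [acc]"
| "stage K (y # ys) T acc = pencil (y # ys) (admissible K acc T) acc"

fun others :: "nat \<Rightarrow> trie list list \<Rightarrow> trie list" where
  "others i [] = []"
| "others 0 (a # as) = concat as"
| "others (Suc i) (a # as) = a @ others i as"

text \<open>A step \<open>(i, x, ys, T)\<close> demands that in the plane with index
  \<open>i\<close> the point \<open>x\<close> be joined to all points of \<open>ys\<close>, new
  lines being drawn from \<open>T\<close>.\<close>

type_synonym step = "nat \<times> bool list \<times> bool list list \<times> trie list"

text \<open>A state lists, for each plane, the lines known so far; the result collects the states
  that survive all steps. An empty result refutes the existence of the planes.\<close>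

fun search :: "step list \<Rightarrow> trie list list \<Rightarrow> trie list list list"
  and search_branch :: "nat \<Rightarrow> step list \<Rightarrow> trie list list \<Rightarrow> trie list list \<Rightarrow> trie list list list"
where
  "search [] st = [st]"
| "search ((i, x, ys, T) # ps) st =
     search_branch i ps st (stage (others i st) (uncovered x (st ! i) ys) T (st ! i))"
| "search_branch i ps st [] = []"
| "search_branch i ps st (a # as) = search ps (st[i := a]) @ search_branch i ps st as"

fun incident :: "trie list \<Rightarrow> bool list \<Rightarrow> trie list" where
  "incident [] p = []"
| "incident (l # ls) p = keep (mem l p) l (incident ls p)"

fun joins :: "trie list \<Rightarrow> bool list list \<Rightarrow> trie list" where
  "joins ls [] = []"
| "joins ls (p # ps) = incident ls p @ joins ls ps"

fun on_some :: "trie list \<Rightarrow> bool list \<Rightarrow> bool"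
  and on_some_step :: "bool \<Rightarrow> trie list \<Rightarrow> bool list \<Rightarrow> bool"
where
  "on_some [] p = False"
| "on_some (l # ls) p = on_some_step (mem l p) ls p"
| "on_some_step True ls p = True"
| "on_some_step False ls p = on_some ls p"

fun remove_on :: "trie list \<Rightarrow> (bool list \<times> trie list) list \<Rightarrow> (bool list \<times> trie list) list" where
  "remove_on ls [] = []"
| "remove_on ls ((w, lw) # ws) = keep (\<not> on_some ls w) (w, lw) (remove_on ls ws)"

lemma length_remove_on: "length (remove_on ls ws) \<le> length ws"
  by (induction ls ws rule: remove_on.induct) (auto intro: order_trans[OF length_keep])

text \<open>Extends the partial arc \<open>s\<close> by \<open>k\<close> points. Each available
  point carries the lines through it, so after adding \<open>z\<close> the points on the lines from
  \<open>z\<close> to \<open>s\<close> can be struck out. Points skipped earlier do not return,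
  hence an arc is not repeated for every ordering of its points.\<close>

function gen :: "nat \<Rightarrow> bool list list \<Rightarrow> (bool list \<times> trie list) list \<Rightarrow> trie list" where
  "gen 0 s av = [mktrie s]"
| "gen (Suc k) s [] = []"
| "gen (Suc k) s ((z, lz) # av) = gen k (z # s) (remove_on (joins lz s) av) @ gen (Suc k) s av"
  by pat_completeness auto
termination
  by (relation "measure (\<lambda>(k, s, av). length av + k)")
     (auto simp: less_Suc_eq_le le_SucI length_remove_on)

fun secants :: "trie \<Rightarrow> trie list \<Rightarrow> trie list" where
  "secants s [] = []"
| "secants s (l # ls) = keep (\<not> le1 (cnt l s 0)) l (secants s ls)"

fun with_lines :: "trie list \<Rightarrow> bool list list \<Rightarrow> (bool list \<times> trie list) list" where
  "with_lines A [] = []"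
| "with_lines A (p # ps) = (p, incident A p) # with_lines A ps"

definition arcs :: "trie list \<Rightarrow> nat \<Rightarrow> bool list list \<Rightarrow> bool list list \<Rightarrow> trie list" where
  "arcs A k s av = gen k s (remove_on (secants (mktrie s) A) (with_lines A av))"

fun on_lines :: "trie list \<Rightarrow> bool list list \<Rightarrow> bool list list" where
  "on_lines ls [] = []"
| "on_lines ls (y # ys) = keep (on_some ls y) y (on_lines ls ys)"

fun off_lines :: "trie list \<Rightarrow> bool list list \<Rightarrow> bool list list" where
  "off_lines ls [] = []"
| "off_lines ls (y # ys) = keep (\<not> on_some ls y) y (off_lines ls ys)"

text \<open>Applied to the lines through a point of \<open>s\<close>, where it selects the tangents
  at that point; in general lines missing \<open>s\<close> pass as well.\<close>

fun tangents :: "trie \<Rightarrow> trie list \<Rightarrow> trie list" where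
  "tangents s [] = []"
| "tangents s (l # ls) = keep (le1 (cnt l s 0)) l (tangents s ls)"

section \<open>Meaning of the executable functions; completeness of the search and of the generation
  of arcs\<close>

fun pts :: "trie \<Rightarrow> bool list set" where
  "pts Empty = {}"
| "pts Here = {[]}"
| "pts (Node a b) = Cons False ` pts a \<union> Cons True ` pts b"

lemma mem_iff: "mem t p \<longleftrightarrow> p \<in> pts t"
  by (induction t p rule: mem.induct) auto

lemma finite_pts [simp]: "finite (pts t)"
  by (induction t) auto

lemma cnt_eq: "cnt a b n = n + card (pts a \<inter> pts b)"
proof (induction a b n rule: cnt.induct)
  case (1 a b c d n)
  have "pts (Node a b) \<inter> pts (Node c d) = Cons False ` (pts a \<inter> pts c) \<union> Cons True ` (pts b \<inter> pts d)"
    by auto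
  moreover have "card \<dots> = card (pts a \<inter> pts c) + card (pts b \<inter> pts d)"
    by (subst card_Un_disjoint) (auto simp: card_image)
  ultimately show ?case using 1 by simp
qed auto

lemma le1_iff: "le1 n \<longleftrightarrow> n \<le> 1"
  by (cases n rule: le1.cases) auto

lemma le2_iff: "le2 n \<longleftrightarrow> n \<le> 2"
  by (cases n) (auto simp: le1_iff)

lemma set_keep: "set (keep b x xs) = (if b then insert x (set xs) else set xs)"
  by (cases b) auto

lemma set_outside: "set (outside m ys) = set ys - pts m"
  by (induction ys) (auto simp: set_keep mem_iff)

lemma set_compats: "set (compats m T) = {t \<in> set T. card (pts m \<inter> pts t) \<le> 1}"
  by (induction T) (auto simp: set_keep cnt_eq le1_iff)

lemma pencil_choose_memI:
  assumes "m \<in> set ms" and "y \<in> pts m" and "r \<in> set (pencil (outside m ys) (compats m T) (m # acc))"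
  shows "r \<in> set (pencil_choose y ys ms T acc)"
  using assms(1)
proof (induction ms)
  case (Cons m' ms)
  then show ?case
    using assms(2,3) by (cases "mem m' y") (auto simp: mem_iff)
qed simp

definition partial_linear :: "bool list set set \<Rightarrow> bool" where
  "partial_linear D \<longleftrightarrow> (\<forall>l\<in>D. \<forall>m\<in>D. l \<noteq> m \<longrightarrow> card (l \<inter> m) \<le> 1)"

lemma partial_linearD:
  "partial_linear D \<Longrightarrow> l \<in> D \<Longrightarrow> m \<in> D \<Longrightarrow> l \<noteq> m \<Longrightarrow> card (l \<inter> m) \<le> 1"
  by (auto simp: partial_linear_def)

text \<open>The branch to follow is the one that picks lines of \<open>D\<close>. After the line
  \<open>m\<close> is chosen, a point outside \<open>m\<close> lies on a line of \<open>D\<close>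
  different from \<open>m\<close>; the two share at most one point, so that line survives
  \<open>compats\<close> and the induction continues.\<close>

lemma pencil_complete:
  assumes "partial_linear D" and "pts ` set acc \<subseteq> D"
    and "\<And>y. y \<in> set ys \<Longrightarrow> \<exists>m\<in>set T. pts m \<in> D \<and> y \<in> pts m"
  shows "\<exists>r\<in>set (pencil ys T acc). pts ` set r \<subseteq> D \<and> set acc \<subseteq> set r"
  using assms(2,3)
proof (induction "length ys" arbitrary: ys T acc rule: less_induct)
  case less
  show ?case
  proof (cases ys)
    case (Cons y ys')
    obtain m where m: "m \<in> set T" "pts m \<in> D" "y \<in> pts m"
      using less.prems(2)[of y] Cons by auto
    have "\<exists>m'\<in>set (compats m T). pts m' \<in> D \<and> z \<in> pts m'" if z: "z \<in> set (outside m ys')" for z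
    proof -
      obtain m' where m': "m' \<in> set T" "pts m' \<in> D" "z \<in> pts m'"
        using less.prems(2)[of z] z Cons by (auto simp: set_outside)
      moreover have "pts m \<noteq> pts m'"
        using z m'(3) by (auto simp: set_outside)
      ultimately show ?thesis
        using partial_linearD[OF assms(1) m(2)] by (auto simp: set_compats)
    qed
    moreover have "length (outside m ys') < length ys"
      using length_outside[of m ys'] Cons by simp
    moreover have "pts ` set (m # acc) \<subseteq> D"
      using less.prems(1) m(2) by simp
    ultimately obtain r where r: "r \<in> set (pencil (outside m ys') (compats m T) (m # acc))"
        "pts ` set r \<subseteq> D" "set (m # acc) \<subseteq> set r"
      using less.hyps[of "outside m ys'" "m # acc" "compats m T"] by blast
    have "r \<in> set (pencil ys T acc)"
      using pencil_choose_memI[OF m(1,3) r(1)] Cons by simp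
    then show ?thesis
      using r(2,3) by auto
  qed (use less.prems in auto)
qed

lemma set_uncovered: "set (uncovered x acc ys) = {y \<in> set ys. \<forall>t\<in>set acc. x \<in> pts t \<longrightarrow> y \<notin> pts t}"
proof (induction acc)
  case (Cons t acc)
  then show ?case
    by (cases "mem t x") (auto simp: set_outside mem_iff)
qed simp

lemma ok2_iff: "ok2 t K \<longleftrightarrow> (\<forall>k\<in>set K. card (pts t \<inter> pts k) \<le> 2)"
proof (induction K)
  case (Cons k K)
  then show ?case
    by (cases "le2 (cnt t k 0)") (auto simp: cnt_eq le2_iff)
qed simp

lemma ok1_iff:
  "ok1 t acc K \<longleftrightarrow> (\<forall>a\<in>set acc. card (pts t \<inter> pts a) \<le> 1) \<and> (\<forall>k\<in>set K. card (pts t \<inter> pts k) \<le> 2)"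
proof (induction acc)
  case (Cons a acc)
  then show ?case
    by (cases "le1 (cnt t a 0)") (auto simp: cnt_eq le1_iff)
qed (simp add: ok2_iff)

lemma set_admissible: "set (admissible K acc T) = {t \<in> set T. ok1 t acc K}"
  by (induction T) (auto simp: set_keep)

text \<open>Lines of \<open>D\<close> pass the filter because they meet \<open>acc\<close> and
  \<open>K\<close> as required. The line from \<open>x\<close> to an uncovered point is not in
  \<open>acc\<close>, since it would have covered that point; this is why \<open>T\<close> has to
  supply only lines outside \<open>acc\<close>.\<close>

lemma stage_complete:
  assumes D: "partial_linear D" and acc: "pts ` set acc \<subseteq> D"
    and K: "\<And>l k. l \<in> D \<Longrightarrow> k \<in> set K \<Longrightarrow> card (l \<inter> pts k) \<le> 2"
    and T: "\<And>y l. y \<in> set ys \<Longrightarrow> l \<in> D \<Longrightarrow> x \<in> l \<Longrightarrow> y \<in> l \<Longrightarrow> l \<notin> pts ` set acc \<Longrightarrow> l \<in> pts ` set T"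
    and join: "\<And>y. y \<in> set ys \<Longrightarrow> \<exists>l\<in>D. x \<in> l \<and> y \<in> l"
  shows "\<exists>r\<in>set (stage K (uncovered x acc ys) T acc). pts ` set r \<subseteq> D \<and> set acc \<subseteq> set r"
proof (cases "uncovered x acc ys")
  case Nil
  then show ?thesis using acc by auto
next
  case (Cons z zs)
  have "\<exists>m\<in>set (admissible K acc T). pts m \<in> D \<and> y \<in> pts m" if y: "y \<in> set (uncovered x acc ys)" for y
  proof -
    obtain l where l: "l \<in> D" "x \<in> l" "y \<in> l"
      using join[of y] y by (auto simp: set_uncovered)
    have new: "l \<notin> pts ` set acc"
      using y l by (auto simp: set_uncovered)
    then obtain m where m: "m \<in> set T" "pts m = l"
      using T[of y l] y l by (auto simp: set_uncovered)
    have "card (pts m \<inter> pts a) \<le> 1" if "a \<in> set acc" for a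
      using partial_linearD[OF D, of l "pts a"] acc that new m l by (auto simp: image_iff)
    then have "ok1 m acc K"
      using K l m by (auto simp: ok1_iff)
    then show ?thesis
      using m l by (auto simp: set_admissible)
  qed
  then show ?thesis
    using pencil_complete[OF D acc, of "uncovered x acc ys"] Cons by auto
qed

lemma set_others: "set (others i as) = (\<Union>j\<in>{..<length as} - {i}. set (as ! j))"
proof (induction i as rule: others.induct)
  case (2 a as)
  have "{..<length (a # as)} - {0} = Suc ` {..<length as}"
    by (auto simp: lessThan_Suc_eq_insert_0)
  moreover have "\<Union> (set ` set as) = (\<Union>j\<in>{..<length as}. set (as ! j))"
    by (metis (no_types, lifting) SUP_cong atLeast0LessThan image_image list.set_map map_nth set_upt)
  ultimately show ?case by simp
next
  case (3 i a as)
  have "{..<length (a # as)} - {Suc i} = insert 0 (Suc ` ({..<length as} - {i}))"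
    by (auto simp: lessThan_Suc_eq_insert_0)
  then show ?case using 3 by simp
qed simp

text \<open>Only joining lines that are not yet known must occur in \<open>T\<close>. This allows
  the candidate lists of the first plane to omit the initial line, and it makes validity persist
  while the state grows.\<close>

fun valid_step :: "bool list set set list \<Rightarrow> trie list list \<Rightarrow> step \<Rightarrow> bool" where
  "valid_step Ds st (i, x, ys, T) \<longleftrightarrow> i < length Ds \<and>
     (\<forall>y\<in>set ys. (\<exists>l\<in>Ds ! i. x \<in> l \<and> y \<in> l) \<and>
        (\<forall>l\<in>Ds ! i. x \<in> l \<longrightarrow> y \<in> l \<longrightarrow> l \<notin> pts ` set (st ! i) \<longrightarrow> l \<in> pts ` set T))"

lemma search_branch_memI:
  "a \<in> set as \<Longrightarrow> r \<in> set (search ps (st[i := a])) \<Longrightarrow> r \<in> set (search_branch i ps st as)"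
  by (induction as) auto

text \<open>The invariant is that all known lines belong to the actual planes \<open>Ds\<close>. By
  \<open>stage_complete\<close> every step has a branch that preserves it, so actual planes always
  leave a surviving state.\<close>

lemma search_complete:
  assumes "\<And>i. i < length Ds \<Longrightarrow> partial_linear (Ds ! i)"
    and "\<And>i j l k. i < length Ds \<Longrightarrow> j < length Ds \<Longrightarrow> i \<noteq> j \<Longrightarrow> l \<in> Ds ! i \<Longrightarrow> k \<in> Ds ! j \<Longrightarrow> card (l \<inter> k) \<le> 2"
    and "length st = length Ds"
    and "\<And>i. i < length Ds \<Longrightarrow> pts ` set (st ! i) \<subseteq> Ds ! i"
    and "\<And>p. p \<in> set ps \<Longrightarrow> valid_step Ds st p"
  shows "search ps st \<noteq> []"
  using assms(3-5)
proof (induction ps arbitrary: st)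
  case (Cons p ps)
  obtain i x ys T where p: "p = (i, x, ys, T)" by (cases p)
  have v: "valid_step Ds st (i, x, ys, T)" using Cons.prems(3)[of p] p by simp
  then have i: "i < length Ds" by simp
  have "card (l \<inter> pts k) \<le> 2" if l: "l \<in> Ds ! i" and k: "k \<in> set (others i st)" for l k
  proof -
    obtain j where "j < length Ds" "j \<noteq> i" "k \<in> set (st ! j)"
      using k Cons.prems(1) by (auto simp: set_others)
    then show ?thesis
      using assms(2)[of i j l "pts k"] Cons.prems(2)[of j] i l by auto
  qed
  then obtain r where r: "r \<in> set (stage (others i st) (uncovered x (st ! i) ys) T (st ! i))"
      "pts ` set r \<subseteq> Ds ! i" "set (st ! i) \<subseteq> set r"
    using stage_complete[OF assms(1)[OF i] Cons.prems(2)[OF i], of "others i st" ys x T] v by auto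
  let ?st = "st[i := r]"
  have "valid_step Ds ?st q" if "q \<in> set ps" for q
  proof -
    obtain j x' ys' T' where q: "q = (j, x', ys', T')" by (cases q)
    have "valid_step Ds st (j, x', ys', T')" using Cons.prems(3)[of q] that q by simp
    \<comment> \<open>States only grow, so the lines exempt from the candidate lists only
      increase.\<close>
    moreover have "pts ` set (st ! j) \<subseteq> pts ` set (?st ! j)"
      using r(3) i Cons.prems(1) by (cases "j = i") auto
    ultimately show ?thesis unfolding q valid_step.simps by (meson subsetD)
  qed
  moreover have "pts ` set (?st ! j) \<subseteq> Ds ! j" if "j < length Ds" for j
    using r(2) Cons.prems that by (cases "j = i") auto
  ultimately have "search ps ?st \<noteq> []"
    using Cons.IH[of ?st] Cons.prems(1) by simp
  then show ?case
    using search_branch_memI[OF r(1)] p by (metis list.set_intros(1) neq_Nil_conv search.simps(2) empty_iff list.set(1))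
qed simp

text \<open>arcs\<close>

definition is_arc :: "trie list \<Rightarrow> bool list set \<Rightarrow> bool" where
  "is_arc A l \<longleftrightarrow> finite l \<and> (\<forall>t\<in>set A. card (l \<inter> pts t) \<le> 2)"

text \<open>The invariant that all strings have length \<open>n\<close>. Without it
  \<open>ins\<close> loses strings: it stops at a leaf, and it overwrites a whole subtree when the
  string is exhausted.\<close>

fun depth :: "nat \<Rightarrow> trie \<Rightarrow> bool" where
  "depth n Empty = True"
| "depth n Here = (n = 0)"
| "depth 0 (Node a b) = False"
| "depth (Suc n) (Node a b) = (depth n a \<and> depth n b)"

lemma ins_correct:
  "depth n t \<Longrightarrow> length p = n \<Longrightarrow> depth n (ins p t) \<and> pts (ins p t) = insert p (pts t)"
proof (induction p t arbitrary: n rule: ins.induct)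
  case (1 t)
  then show ?case by (cases t) auto
next
  case (2 p a b)
  then show ?case by (cases n) auto
next
  case (3 p a b)
  then show ?case by (cases n) auto
next
  case (4 p)
  then show ?case by (cases n) auto
next
  case (5 p)
  then show ?case by (cases n) auto
qed auto

lemma mktrie_correct:
  assumes "\<And>p. p \<in> set ps \<Longrightarrow> length p = n"
  shows "depth n (mktrie ps) \<and> pts (mktrie ps) = set ps"
  using assms
proof (induction ps)
  case (Cons p ps)
  then show ?case using ins_correct[of n "mktrie ps" p] by simp
qed simp

lemma set_incident: "set (incident A p) = {l \<in> set A. p \<in> pts l}"
  by (induction A) (auto simp: set_keep mem_iff)

lemma set_joins: "set (joins A ps) = {l \<in> set A. \<exists>p\<in>set ps. p \<in> pts l}"
  by (induction ps) (auto simp: set_incident)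

lemma on_some_iff: "on_some ls p \<longleftrightarrow> (\<exists>l\<in>set ls. p \<in> pts l)"
proof (induction ls)
  case (Cons l ls)
  then show ?case by (cases "mem l p") (auto simp: mem_iff)
qed simp

lemma set_remove_on: "set (remove_on ls ws) = {(w, lw) \<in> set ws. \<not> on_some ls w}"
  by (induction ls ws rule: remove_on.induct) (auto simp: set_keep)

lemma set_secants: "set (secants s A) = {l \<in> set A. \<not> card (pts l \<inter> pts s) \<le> 1}"
proof (induction A)
  case (Cons l A)
  show ?case unfolding secants.simps set_keep Cons cnt_eq le1_iff by auto
qed simp

lemma set_with_lines: "set (with_lines A ps) = (\<lambda>p. (p, incident A p)) ` set ps"
  by (induction ps) auto

text \<open>The branch to follow takes \<open>z\<close> exactly if \<open>z\<close> is a new point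
  of \<open>l\<close>. A point struck out after that lies on a line through \<open>z\<close> and a
  point of \<open>s\<close>; as \<open>l\<close> already has two points there, it cannot contain a
  third, so nothing of \<open>l\<close> is lost.\<close>

lemma gen_complete:
  assumes "is_arc A l" and "set s \<subseteq> l" and "l \<subseteq> set s \<union> fst ` set av" and "card (l - set s) = k"
    and "\<And>z lz. (z, lz) \<in> set av \<Longrightarrow> set lz \<subseteq> {t \<in> set A. z \<in> pts t}"
    and "\<And>p. p \<in> l \<Longrightarrow> length p = n"
  shows "l \<in> pts ` set (gen k s av)"
  using assms(2-5)
proof (induction k s av rule: gen.induct)
  case (1 s av)
  have "finite l" using assms(1) by (simp add: is_arc_def)
  then have "l = set s" using 1 by auto
  then show ?case using mktrie_correct[of s n] assms(6) by auto
next
  case (2 k s)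
  then have "l - set s = {}" by auto
  then have "card (l - set s) = 0" by (metis card.empty)
  then show ?case using "2.prems"(3) by simp
next
  case (3 k s z lz av)
  have fin: "finite l" and arc: "\<And>t. t \<in> set A \<Longrightarrow> card (l \<inter> pts t) \<le> 2"
    using assms(1) by (auto simp: is_arc_def)
  show ?case
  proof (cases "z \<in> l - set s")
    case True
    have lz: "set lz \<subseteq> {t \<in> set A. z \<in> pts t}" using "3.prems"(4)[of z lz] by simp
    have "\<not> on_some (joins lz s) w" if w: "w \<in> l - set (z # s)" for w
    proof
      assume "on_some (joins lz s) w"
      then obtain t p where t: "t \<in> set lz" "w \<in> pts t" "p \<in> set s" "p \<in> pts t"
        by (auto simp: on_some_iff set_joins)
      have "{w, p, z} \<subseteq> l \<inter> pts t" using t True w lz "3.prems"(1) by auto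
      moreover have "card {w, p, z} = 3" using t(3) True w by (subst card_3_iff) (metis Diff_iff list.set_intros(1,2))
      ultimately have "3 \<le> card (l \<inter> pts t)" using fin by (metis card_mono finite_Int)
      moreover have "t \<in> set A" using t lz by auto
      ultimately show False using arc[of t] by simp
    qed
    moreover have "w \<in> fst ` set av" if "w \<in> l - set (z # s)" for w
      using "3.prems"(2) that by auto
    ultimately have "l \<subseteq> set (z # s) \<union> fst ` set (remove_on (joins lz s) av)"
      by (force simp: set_remove_on)
    moreover have "card (l - set (z # s)) = k"
    proof -
      have "l - set (z # s) = (l - set s) - {z}" by auto
      then show ?thesis using "3.prems"(3) True fin by simp
    qed
    moreover have "set (z # s) \<subseteq> l" using "3.prems"(1) True by auto
    moreover have "\<And>y ly. (y, ly) \<in> set (remove_on (joins lz s) av) \<Longrightarrow> set ly \<subseteq> {t \<in> set A. y \<in> pts t}"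
      using "3.prems"(4) by (auto simp: set_remove_on)
    ultimately have "l \<in> pts ` set (gen k (z # s) (remove_on (joins lz s) av))"
      using "3.IH"(1) by blast
    then show ?thesis by auto
  next
    case False
    then have "l \<subseteq> set s \<union> fst ` set av" using "3.prems"(2) by auto
    then have "l \<in> pts ` set (gen (Suc k) s av)"
      using "3.IH"(2) "3.prems" by (meson list.set_intros(2))
    then show ?thesis by auto
  qed
qed

text \<open>A line with two points of \<open>s\<close> contains no further point of the arc
  \<open>l\<close>, so deleting the points on secants of \<open>s\<close> at the start is harmless;
  \<open>gen_complete\<close> does the rest.\<close>

lemma arcs_complete:
  assumes "is_arc A l" and "set s \<subseteq> l" and "l \<subseteq> set s \<union> set av" and "card l = k + card (set s)"
    and len: "\<And>p. p \<in> l \<Longrightarrow> length p = n"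
  shows "l \<in> pts ` set (arcs A k s av)"
proof -
  have fin: "finite l" and arc: "\<And>t. t \<in> set A \<Longrightarrow> card (l \<inter> pts t) \<le> 2"
    using assms(1) by (auto simp: is_arc_def)
  have s: "pts (mktrie s) = set s" using mktrie_correct[of s n] len assms(2) by auto
  have "\<not> on_some (secants (mktrie s) A) w" if w: "w \<in> l - set s" for w
  proof
    assume "on_some (secants (mktrie s) A) w"
    then obtain t where t: "t \<in> set A" "\<not> card (pts t \<inter> set s) \<le> 1" "w \<in> pts t"
      by (auto simp: on_some_iff set_secants s)
    have "card (insert w (pts t \<inter> set s)) \<le> card (l \<inter> pts t)"
      using w t assms(2) fin by (intro card_mono) auto
    then show False using arc[OF t(1)] t(2) w by simp
  qed
  then have "l \<subseteq> set s \<union> fst ` set (remove_on (secants (mktrie s) A) (with_lines A av))"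
    using assms(3) by (force simp: set_remove_on set_with_lines)
  moreover have "card (l - set s) = k"
    using assms(2,4) fin by (simp add: card_Diff_subset)
  ultimately show ?thesis
    unfolding arcs_def using assms(1,2) len
    by (intro gen_complete[of A l _ _ _ n]) (auto simp: set_remove_on set_with_lines set_incident)
qed

lemma set_on_lines: "set (on_lines ls ys) = {y \<in> set ys. on_some ls y}"
  by (induction ys) (auto simp: set_keep)
lemma set_off_lines: "set (off_lines ls ys) = {y \<in> set ys. \<not> on_some ls y}"
  by (induction ys) (auto simp: set_keep)

section \<open>Encoded projective planes and the schedules of the searches\<close>

datatype 'a vec = Vec 'a 'a 'a

fun dot :: "'a::comm_ring_1 vec \<Rightarrow> 'a vec \<Rightarrow> 'a" where
  "dot (Vec a b c) (Vec x y z) = a * x + b * y + c * z"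

fun scale :: "'a::comm_ring_1 \<Rightarrow> 'a vec \<Rightarrow> 'a vec" where
  "scale k (Vec x y z) = Vec (k * x) (k * y) (k * z)"

fun vnormalize :: "'a::field vec \<Rightarrow> 'a vec" where
  "vnormalize (Vec x y z) =
     (if x \<noteq> 0 then Vec 1 (y / x) (z / x) else if y \<noteq> 0 then Vec 0 1 (z / y) else Vec 0 0 1)"

text \<open>One vector for each of the q^2 + q + 1 projective points, with first nonzero entry 1.
  The order matters: the permutations in \<open>tbs2\<close> to \<open>tbs5\<close> refer to
  positions in this list.\<close>

fun vecs :: "'a::field list \<Rightarrow> 'a vec list" where
  "vecs els = Vec 0 0 1 # map (Vec 0 1) els @ map (\<lambda>(a, b). Vec 1 a b) (List.product els els)"

fun perp :: "'a::field vec \<Rightarrow> (bool list \<times> 'a vec) list \<Rightarrow> bool list list" where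
  "perp w [] = []"
| "perp w ((p, v) # tb) = keep (dot w v = 0) p (perp w tb)"

fun perps :: "'a::field vec list \<Rightarrow> (bool list \<times> 'a vec) list \<Rightarrow> trie list" where
  "perps [] tb = []"
| "perps (w # ws) tb = mktrie (perp w tb) # perps ws tb"

fun code :: "(bool list \<times> 'a vec) list \<Rightarrow> 'a vec \<Rightarrow> bool list"
  and code_step :: "bool \<Rightarrow> bool list \<Rightarrow> (bool list \<times> 'a vec) list \<Rightarrow> 'a vec \<Rightarrow> bool list"
where
  "code [] v = []"
| "code ((p, w) # tb) v = code_step (w = v) p tb v"
| "code_step True p tb v = p"
| "code_step False p tb v = code tb v"

fun codes :: "(bool list \<times> 'a vec) list \<Rightarrow> 'a vec list \<Rightarrow> bool list list" where
  "codes tb [] = []"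
| "codes tb (v # vs) = code tb v # codes tb vs"

text \<open>\<open>zip\<close> discards surplus code words; it loses no vector as long as 2^d is at
  least the number of points, and \<open>valid_table\<close> tests this.\<close>

definition table :: "'a::field list \<Rightarrow> nat \<Rightarrow> (bool list \<times> 'a vec) list" where
  "table els d = zip (List.n_lists d [False, True]) (vecs els)"

definition points_of :: "(bool list \<times> 'a vec) list \<Rightarrow> bool list list" where
  "points_of tb = map fst tb"

definition lines_of :: "(bool list \<times> 'a::field vec) list \<Rightarrow> trie list" where
  "lines_of tb = perps (map snd tb) tb"

fun inside :: "trie \<Rightarrow> bool list list \<Rightarrow> bool list list" where
  "inside m [] = []"
| "inside m (y # ys) = keep (mem m y) y (inside m ys)"

fun pair_steps :: "trie list \<Rightarrow> nat \<Rightarrow> nat \<Rightarrow> bool list \<Rightarrow> bool list list \<Rightarrow> bool list list \<Rightarrow> step list" where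
  "pair_steps A k i x V [] = []"
| "pair_steps A k i x V (y # ys) = (i, x, [y], arcs A k [y, x] V) # pair_steps A k i x V ys"

text \<open>The lines \<open>ts\<close> steer the order of branching. If \<open>t\<close> is a
  tangent of the initial arc at \<open>x\<close>, then the q other points of \<open>t\<close> are
  off that arc and lie on different lines of the pencil at \<open>x\<close>, because an arc has at
  most two points on \<open>t\<close>. Treating these points first therefore settles the whole
  pencil.\<close>

fun pencil_step :: "trie list \<Rightarrow> nat \<Rightarrow> nat \<Rightarrow> bool list \<Rightarrow> trie list \<Rightarrow> bool list list \<Rightarrow> step" where
  "pencil_step A q i x ts av = (i, x, on_lines ts av @ off_lines ts av, arcs A q [x] av)"

fun pencil_steps :: "trie list \<Rightarrow> nat \<Rightarrow> trie \<Rightarrow> bool list list \<Rightarrow> bool list list \<Rightarrow> step list" where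
  "pencil_steps A q m [] off = []"
| "pencil_steps A q m (x # xs) off =
     pencil_step A q 0 x (tangents m (incident A x)) off # pencil_steps A q m xs off"

fun plane_steps :: "trie list \<Rightarrow> nat \<Rightarrow> nat \<Rightarrow> bool list list \<Rightarrow> bool list list \<Rightarrow> step list" where
  "plane_steps A q i V [] = []"
| "plane_steps A q i V (x # xs) =
     pencil_step A q i x [] (outside (mktrie [x]) V) # plane_steps A q i V xs"

fun all_plane_steps :: "trie list \<Rightarrow> nat \<Rightarrow> bool list list \<Rightarrow> bool list list \<Rightarrow> nat list \<Rightarrow> step list" where
  "all_plane_steps A q V xs [] = []"
| "all_plane_steps A q V xs (i # is) = plane_steps A q i V xs @ all_plane_steps A q V xs is"

text \<open>Alternates between two planes: after the pencil of plane 0 at a point \<open>x\<close>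
  of the initial line come the lines of plane 1 joining \<open>x\<close> to the earlier points of
  that line, so that each plane restricts the other early.\<close>

fun mixed_steps :: "trie list \<Rightarrow> nat \<Rightarrow> bool list list \<Rightarrow> trie \<Rightarrow> bool list list \<Rightarrow> bool list list \<Rightarrow> bool list list \<Rightarrow> step list" where
  "mixed_steps A k V m off prev [] = []"
| "mixed_steps A k V m off prev (x # xs) =
     pencil_step A (Suc k) 0 x (tangents m (incident A x)) off #
     pair_steps A k (Suc 0) x V prev @ mixed_steps A k V m off (x # prev) xs"

section \<open>Homogeneous vectors and their normalised representatives\<close>

fun cross :: "'a::field vec \<Rightarrow> 'a vec \<Rightarrow> 'a vec" where
  "cross (Vec a b c) (Vec x y z) = Vec (b * z - c * y) (c * x - a * z) (a * y - b * x)"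

abbreviation zero_vec :: "'a::field vec" where "zero_vec \<equiv> Vec 0 0 0"

definition ray :: "'a::field vec \<Rightarrow> 'a vec set" where
  "ray v = range (\<lambda>k. scale k v)"

lemma scale_scale: "scale j (scale k v) = scale (j * k) v"
  by (cases v) (simp add: mult.assoc)

lemma scale_1 [simp]: "scale 1 v = v"
  by (cases v) simp

lemma scale_eq_zero_iff: "scale (k::'a::field) v = zero_vec \<longleftrightarrow> k = 0 \<or> v = zero_vec"
  by (cases v) auto

lemma dot_scale: "dot w (scale k v) = k * dot w v" "dot (scale k w) v = k * dot w v"
  by (cases v; cases w; simp add: algebra_simps)+

lemma dot_commute: "dot w v = dot v w"
  by (cases v; cases w; simp add: algebra_simps)

lemma normalize_scale: "k \<noteq> 0 \<Longrightarrow> vnormalize (scale k v) = vnormalize v"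
  by (cases v) (auto simp: field_simps)

lemma normalize_eq_scale:
  assumes "v \<noteq> zero_vec"
  obtains k where "k \<noteq> 0" and "vnormalize v = scale k v"
proof -
  obtain x y z where v: "v = Vec x y z" by (cases v)
  consider "x \<noteq> 0" | "x = 0" "y \<noteq> 0" | "x = 0" "y = 0" "z \<noteq> 0" using assms v by auto
  then show ?thesis
  proof cases
    case 1
    then show ?thesis using that[of "inverse x"] v by (simp add: field_simps)
  next
    case 2
    then show ?thesis using that[of "inverse y"] v by (simp add: field_simps)
  next
    case 3
    then show ?thesis using that[of "inverse z"] v by (simp add: field_simps)
  qed
qed

lemma normalize_nonzero: "vnormalize v \<noteq> zero_vec"
  by (cases v) auto

lemma normalize_idem: "vnormalize (vnormalize v) = vnormalize v"
  by (cases v) auto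

lemma normalize_eq_iff:
  assumes "u \<noteq> zero_vec" "v \<noteq> zero_vec"
  shows "vnormalize u = vnormalize v \<longleftrightarrow> (\<exists>k. k \<noteq> 0 \<and> u = scale k v)"
proof
  assume eq: "vnormalize u = vnormalize v"
  obtain j k where j: "j \<noteq> 0" "vnormalize u = scale j u" and k: "k \<noteq> 0" "vnormalize v = scale k v"
    using normalize_eq_scale assms by metis
  have "u = scale (inverse j) (scale j u)" using j(1) by (simp add: scale_scale)
  also have "\<dots> = scale (inverse j * k) v" using eq j(2) k(2) by (simp add: scale_scale)
  finally show "\<exists>k. k \<noteq> 0 \<and> u = scale k v" using j(1) k(1) by (intro exI[of _ "inverse j * k"]) auto
qed (auto simp: normalize_scale)

lemma dot_normalize_eq_zero_iff:
  assumes "v \<noteq> zero_vec"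
  shows "dot w (vnormalize v) = 0 \<longleftrightarrow> dot w v = 0"
    and "dot (vnormalize v) w = 0 \<longleftrightarrow> dot v w = 0"
  using normalize_eq_scale[OF assms] by (metis dot_scale(1) mult_eq_0_iff, metis dot_scale(2) mult_eq_0_iff)

lemma ray_eq_iff:
  assumes "u \<noteq> zero_vec" "v \<noteq> zero_vec"
  shows "ray u = ray v \<longleftrightarrow> vnormalize u = vnormalize v"
proof
  assume "ray u = ray v"
  moreover have "u \<in> ray u" unfolding ray_def by (metis rangeI scale_1)
  ultimately obtain k where "u = scale k v" by (auto simp: ray_def)
  moreover then have "k \<noteq> 0" using assms scale_eq_zero_iff by metis
  ultimately show "vnormalize u = vnormalize v" by (simp add: normalize_scale)
next
  assume "vnormalize u = vnormalize v"
  then obtain k where k: "k \<noteq> 0" "u = scale k v" using normalize_eq_iff assms by blast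
  have "range (\<lambda>j. scale j (scale k v)) = (\<lambda>j. scale j v) ` range (\<lambda>j. j * k)"
    by (simp add: scale_scale image_image)
  moreover have "range (\<lambda>j. j * k) = UNIV"
    using k(1) by (intro surjI[of _ "\<lambda>j. j / k"]) simp
  ultimately show "ray u = ray v" using k by (simp add: ray_def)
qed

definition normalized :: "'a::field vec set" where
  "normalized = vnormalize ` {v. v \<noteq> zero_vec}"

lemma normalized_iff: "v \<in> normalized \<longleftrightarrow> vnormalize v = v"
proof
  assume "vnormalize v = v"
  then show "v \<in> normalized"
    unfolding normalized_def using normalize_nonzero[of v] by (intro image_eqI[of v vnormalize v]) simp_all
next
  assume "v \<in> normalized"
  then obtain u where "v = vnormalize u" unfolding normalized_def by (rule imageE)
  then show "vnormalize v = v" by (simp only: normalize_idem)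
qed

section \<open>Planes isomorphic to PG(2,q) as planes with homogeneous coordinates\<close>

text \<open>Up to scalars, \<open>c\<close> is an isomorphism onto the projective plane over
  \<open>'a\<close>. The vectors need not be normalised, so a matrix can be applied to them
  directly.\<close>

definition coordinates :: "'b set \<Rightarrow> 'b set set \<Rightarrow> ('b \<Rightarrow> 'a::field vec) \<Rightarrow> bool" where
  "coordinates P L c \<longleftrightarrow> (\<forall>p\<in>P. c p \<noteq> zero_vec) \<and> bij_betw (\<lambda>p. vnormalize (c p)) P normalized \<and>
     L = (\<lambda>w. {p \<in> P. dot w (c p) = 0}) ` {w. w \<noteq> zero_vec}"

text \<open>Relates a field given as a record, as in the definition of PG(2,q), to a field type in
  which arithmetic can be evaluated.\<close>

definition field_iso :: "('k, 'm) ring_scheme \<Rightarrow> ('a::field \<Rightarrow> 'k) \<Rightarrow> bool" where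
  "field_iso F h \<longleftrightarrow> bij_betw h UNIV (carrier F) \<and> h 0 = \<zero>\<^bsub>F\<^esub> \<and> h 1 = \<one>\<^bsub>F\<^esub> \<and>
     (\<forall>a b. h (a + b) = h a \<oplus>\<^bsub>F\<^esub> h b) \<and> (\<forall>a b. h (a * b) = h a \<otimes>\<^bsub>F\<^esub> h b)"

fun triple :: "('a \<Rightarrow> 'k) \<Rightarrow> 'a vec \<Rightarrow> 'k \<times> 'k \<times> 'k" where
  "triple h (Vec x y z) = (h x, h y, h z)"

lemma inj_triple: "inj h \<Longrightarrow> inj (triple h)"
proof (rule injI)
  fix u v assume "inj h" "triple h u = triple h v"
  then show "u = v" by (cases u; cases v) (auto dest: injD)
qed

lemma nonzero_triples_iso:
  assumes "field_iso F h"
  shows "nonzero_triples F = triple h ` {v. v \<noteq> zero_vec}"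
proof -
  have h: "inj h" "carrier F = range h" "\<zero>\<^bsub>F\<^esub> = h 0"
    using assms by (auto simp: field_iso_def bij_betw_def)
  have "(\<zero>\<^bsub>F\<^esub>, \<zero>\<^bsub>F\<^esub>, \<zero>\<^bsub>F\<^esub>) = triple h zero_vec" by (simp add: h)
  moreover have "carrier F \<times> carrier F \<times> carrier F = range (triple h)"
  proof -
    have "(x, y, z) \<in> range (triple h)" if xyz: "x \<in> range h" "y \<in> range h" "z \<in> range h" for x y z
    proof -
      obtain x' y' z' where "x = h x'" "y = h y'" "z = h z'" using xyz by blast
      then show ?thesis by (intro range_eqI[of _ _ "Vec x' y' z'"]) simp
    qed
    moreover have "triple h v \<in> range h \<times> range h \<times> range h" for v by (cases v) auto
    ultimately show ?thesis unfolding h(2) by blast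
  qed
  moreover have "range (triple h) - {triple h zero_vec} = triple h ` {v. v \<noteq> zero_vec}"
    using image_set_diff[OF inj_triple[OF h(1)], of UNIV "{zero_vec}"] by (simp add: Compl_eq_Diff_UNIV[symmetric] Collect_neg_eq[symmetric] set_diff_eq)
  ultimately show ?thesis unfolding nonzero_triples_def by simp
qed

lemma span1_iso:
  assumes "field_iso F h"
  shows "span1 F (triple h v) = triple h ` ray v"
proof -
  have h: "carrier F = range h" "\<And>a b. h (a * b) = h a \<otimes>\<^bsub>F\<^esub> h b"
    using assms by (auto simp: field_iso_def bij_betw_def)
  show ?thesis by (cases v) (auto simp: span1_def ray_def h image_iff)
qed

lemma PG2_points_iso:
  assumes "field_iso F h"
  shows "PG2_points F = (\<lambda>v. triple h ` ray v) ` {v. v \<noteq> zero_vec}"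
  unfolding PG2_points_def nonzero_triples_iso[OF assms] image_image span1_iso[OF assms] ..

lemma PG2_line_iso:
  assumes "field_iso F h"
  shows "PG2_line F (triple h w) = (\<lambda>v. triple h ` ray v) ` {v. v \<noteq> zero_vec \<and> dot w v = 0}"
proof -
  obtain a b c where w: "w = Vec a b c" by (cases w)
  have h: "inj h" "\<zero>\<^bsub>F\<^esub> = h 0" "\<And>a b. h a \<otimes>\<^bsub>F\<^esub> h b = h (a * b)" "\<And>a b. h a \<oplus>\<^bsub>F\<^esub> h b = h (a + b)"
    using assms by (auto simp: field_iso_def bij_betw_def)
  have eq: "h a \<otimes>\<^bsub>F\<^esub> h x \<oplus>\<^bsub>F\<^esub> h b \<otimes>\<^bsub>F\<^esub> h y \<oplus>\<^bsub>F\<^esub> h c \<otimes>\<^bsub>F\<^esub> h z = \<zero>\<^bsub>F\<^esub> \<longleftrightarrow> dot w (Vec x y z) = 0" for x y z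
    using h(1) by (simp add: h w inj_eq)
  have "PG2_line F (triple h w) = {span1 F (triple h v) | v. v \<noteq> zero_vec \<and> dot w v = 0}"
  proof (intro equalityI subsetI)
    fix s assume "s \<in> PG2_line F (triple h w)"
    then obtain x y z where s: "s = span1 F (x, y, z)" "(x, y, z) \<in> nonzero_triples F"
        "h a \<otimes>\<^bsub>F\<^esub> x \<oplus>\<^bsub>F\<^esub> h b \<otimes>\<^bsub>F\<^esub> y \<oplus>\<^bsub>F\<^esub> h c \<otimes>\<^bsub>F\<^esub> z = \<zero>\<^bsub>F\<^esub>"
      by (auto simp: PG2_line_def w)
    then obtain v where v: "v \<noteq> zero_vec" "(x, y, z) = triple h v"
      unfolding nonzero_triples_iso[OF assms] by auto
    then have "dot w v = 0" using s(3) eq by (cases v) auto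
    then show "s \<in> {span1 F (triple h v) | v. v \<noteq> zero_vec \<and> dot w v = 0}" using s(1) v by auto
  next
    fix s assume "s \<in> {span1 F (triple h v) | v. v \<noteq> zero_vec \<and> dot w v = 0}"
    then obtain v where v: "v \<noteq> zero_vec" "dot w v = 0" "s = span1 F (triple h v)" by auto
    obtain x y z where xyz: "v = Vec x y z" by (cases v)
    have "(h x, h y, h z) \<in> nonzero_triples F"
      unfolding nonzero_triples_iso[OF assms] using v(1) xyz by force
    then show "s \<in> PG2_line F (triple h w)"
      using v(2,3) eq[of x y z] unfolding PG2_line_def w xyz triple.simps prod.case by blast
  qed
  then show ?thesis by (auto simp: span1_iso[OF assms])
qed

lemma PG2_lines_iso:
  assumes "field_iso F h"
  shows "PG2_lines F = (\<lambda>w. (\<lambda>v. triple h ` ray v) ` {v. v \<noteq> zero_vec \<and> dot w v = 0}) ` {w. w \<noteq> zero_vec}"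
  unfolding PG2_lines_def nonzero_triples_iso[OF assms] image_image PG2_line_iso[OF assms] ..

text \<open>From an isomorphism, coordinates arise by choosing a spanning vector for the image of
  each point; conversely a point is sent to the span of its coordinate vector. A line is recovered
  from its image since it lies in \<open>P\<close>, where the isomorphism is injective.\<close>

lemma planes_isomorphic_iff_coordinates:
  fixes h :: "'a::field \<Rightarrow> 'k"
  assumes iso: "field_iso F h" and LP: "\<And>l. l \<in> L \<Longrightarrow> l \<subseteq> P"
  shows "planes_isomorphic P L (PG2_points F) (PG2_lines F) \<longleftrightarrow> (\<exists>c :: 'b \<Rightarrow> 'a vec. coordinates P L c)"
proof -
  define r where "r v = triple h ` ray v" for v :: "'a vec"
  have inj_h: "inj (triple h)" using iso inj_triple by (auto simp: field_iso_def bij_betw_def)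
  have r_eq: "r u = r v \<longleftrightarrow> vnormalize u = vnormalize v" if "u \<noteq> zero_vec" "v \<noteq> zero_vec" for u v
    using ray_eq_iff[OF that] inj_h by (simp add: r_def inj_image_eq_iff)
  have pts_eq: "PG2_points F = r ` {v. v \<noteq> zero_vec}"
    using PG2_points_iso[OF iso] by (simp add: r_def[abs_def])
  have lines_eq: "PG2_lines F = (\<lambda>w. r ` {v. v \<noteq> zero_vec \<and> dot w v = 0}) ` {w. w \<noteq> zero_vec}"
    using PG2_lines_iso[OF iso] by (simp add: r_def[abs_def])
  have line_mem: "r v \<in> r ` {v. v \<noteq> zero_vec \<and> dot w v = 0} \<longleftrightarrow> dot w v = 0" if "v \<noteq> zero_vec" for v w
  proof
    assume "r v \<in> r ` {v. v \<noteq> zero_vec \<and> dot w v = 0}"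
    then obtain u where "u \<noteq> zero_vec" "dot w u = 0" "r v = r u" by auto
    then show "dot w v = 0" using r_eq[of v u] that dot_normalize_eq_zero_iff(1) by metis
  qed (use that in auto)
  show ?thesis
  proof
    assume "planes_isomorphic P L (PG2_points F) (PG2_lines F)"
    then obtain f where f: "bij_betw f P (PG2_points F)" "(\<lambda>l. f ` l) ` L = PG2_lines F"
      by (auto simp: planes_isomorphic_def)
    have "\<exists>v. v \<noteq> zero_vec \<and> f p = r v" if "p \<in> P" for p
      using bij_betwE[OF f(1)] that pts_eq by auto
    then obtain c where c: "\<And>p. p \<in> P \<Longrightarrow> c p \<noteq> zero_vec" "\<And>p. p \<in> P \<Longrightarrow> f p = r (c p)" by metis
    have "bij_betw (\<lambda>p. vnormalize (c p)) P normalized"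
      unfolding bij_betw_def
    proof
      show "inj_on (\<lambda>p. vnormalize (c p)) P"
        using f(1) c r_eq by (auto simp: bij_betw_def inj_on_def)
      have "\<exists>p\<in>P. vnormalize v = vnormalize (c p)" if "v \<noteq> zero_vec" for v
      proof -
        have "r v \<in> f ` P" using that bij_betw_imp_surj_on[OF f(1)] pts_eq by auto
        then obtain p where "p \<in> P" "r v = f p" by (rule imageE) auto
        then show ?thesis using c r_eq that by metis
      qed
      then show "(\<lambda>p. vnormalize (c p)) ` P = normalized"
        using c(1) by (auto simp: normalized_def)
    qed
    moreover have "L = (\<lambda>w. {p \<in> P. dot w (c p) = 0}) ` {w. w \<noteq> zero_vec}"
    proof -
      have "f p \<in> r ` {v. v \<noteq> zero_vec \<and> dot w v = 0} \<longleftrightarrow> dot w (c p) = 0" if "p \<in> P" for p w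
        using line_mem[OF c(1)[OF that]] c(2)[OF that] by simp
      then have pre: "{p \<in> P. f p \<in> r ` {v. v \<noteq> zero_vec \<and> dot w v = 0}} = {p \<in> P. dot w (c p) = 0}" for w
        by auto
      have "{p \<in> P. f p \<in> f ` l} = l" if "l \<in> L" for l
        using f(1) LP[OF that] by (auto simp: bij_betw_def inj_on_def)
      then have "(\<lambda>l. {p \<in> P. f p \<in> f ` l}) ` L = (\<lambda>l. l) ` L"
        by (rule image_cong[OF refl])
      then have "L = (\<lambda>m. {p \<in> P. f p \<in> m}) ` (\<lambda>l. f ` l) ` L"
        by (simp add: image_image)
      then show ?thesis
        unfolding f(2) lines_eq image_image pre .
    qed
    ultimately show "\<exists>c :: 'b \<Rightarrow> 'a vec. coordinates P L c"
      using c(1) by (auto simp: coordinates_def)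
  next
    assume "\<exists>c :: 'b \<Rightarrow> 'a vec. coordinates P L c"
    then obtain c :: "'b \<Rightarrow> 'a vec" where c: "\<And>p. p \<in> P \<Longrightarrow> c p \<noteq> zero_vec"
        "bij_betw (\<lambda>p. vnormalize (c p)) P normalized"
        "L = (\<lambda>w. {p \<in> P. dot w (c p) = 0}) ` {w. w \<noteq> zero_vec}"
      by (auto simp: coordinates_def)
    have onto: "\<exists>p\<in>P. r v = r (c p)" if "v \<noteq> zero_vec" for v
    proof -
      have "vnormalize v \<in> normalized" using that by (auto simp: normalized_def)
      then obtain p where "p \<in> P" "vnormalize v = vnormalize (c p)"
        using c(2) by (auto simp: bij_betw_def)
      then show ?thesis using r_eq that c(1) by metis
    qed
    have "bij_betw (\<lambda>p. r (c p)) P (PG2_points F)"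
      unfolding bij_betw_def pts_eq
    proof
      show "inj_on (\<lambda>p. r (c p)) P"
        using c(1,2) r_eq by (auto simp: bij_betw_def inj_on_def)
      have "r v \<in> (\<lambda>p. r (c p)) ` P" if "v \<noteq> zero_vec" for v
        using onto[OF that] by blast
      then show "(\<lambda>p. r (c p)) ` P = r ` {v. v \<noteq> zero_vec}"
        using c(1) by auto
    qed
    moreover have "(\<lambda>p. r (c p)) ` {p \<in> P. dot w (c p) = 0} = r ` {v. v \<noteq> zero_vec \<and> dot w v = 0}" for w
    proof -
      have "r v \<in> (\<lambda>p. r (c p)) ` {p \<in> P. dot w (c p) = 0}" if v: "v \<noteq> zero_vec" "dot w v = 0" for v
      proof -
        obtain p where p: "p \<in> P" "r v = r (c p)" using onto v by blast
        then have "dot w (c p) = 0"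
          using line_mem[of "c p" w] c(1) v by (metis (mono_tags, lifting) imageI mem_Collect_eq)
        then show ?thesis using p by auto
      qed
      then show ?thesis using c(1) by auto
    qed
    ultimately show "planes_isomorphic P L (PG2_points F) (PG2_lines F)"
      unfolding planes_isomorphic_def lines_eq c(3) image_image by blast
  qed
qed

section \<open>Linear changes of coordinates and standard frames\<close>

fun vadd :: "'a::field vec \<Rightarrow> 'a vec \<Rightarrow> 'a vec" where
  "vadd (Vec a b c) (Vec x y z) = Vec (a + x) (b + y) (c + z)"

fun mat :: "'a::field vec \<Rightarrow> 'a vec \<Rightarrow> 'a vec \<Rightarrow> 'a vec \<Rightarrow> 'a vec" where
  "mat r1 r2 r3 v = Vec (dot r1 v) (dot r2 v) (dot r3 v)"

text \<open>Application of the transposed matrix: it gives the action on line equations, see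
  \<open>dot_mat\<close>.\<close>

fun comb :: "'a::field vec \<Rightarrow> 'a vec \<Rightarrow> 'a vec \<Rightarrow> 'a vec \<Rightarrow> 'a vec" where
  "comb r1 r2 r3 (Vec a b c) = vadd (scale a r1) (vadd (scale b r2) (scale c r3))"

lemma dot_mat: "dot w (mat r1 r2 r3 v) = dot (comb r1 r2 r3 w) v"
  by (cases w; cases v; cases r1; cases r2; cases r3) (simp add: algebra_simps)

lemma dot_vadd: "dot w (vadd u v) = dot w u + dot w v"
  by (cases w; cases u; cases v) (simp add: algebra_simps)

lemma mat_scale: "mat r1 r2 r3 (scale k v) = scale k (mat r1 r2 r3 v)"
  by (simp add: dot_scale)

lemma mat_vadd: "mat r1 r2 r3 (vadd u v) = vadd (mat r1 r2 r3 u) (mat r1 r2 r3 v)"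
  by (simp add: dot_vadd)

lemma comb_scale: "comb r1 r2 r3 (scale k v) = scale k (comb r1 r2 r3 v)"
  by (cases v; cases r1; cases r2; cases r3) (simp add: algebra_simps)

lemma comb_vadd: "comb r1 r2 r3 (vadd u v) = vadd (comb r1 r2 r3 u) (comb r1 r2 r3 v)"
  by (cases u; cases v; cases r1; cases r2; cases r3) (simp add: algebra_simps)

lemma vadd_neg_eq_zero_iff: "vadd u (scale (-1) v) = zero_vec \<longleftrightarrow> u = v"
  by (cases u; cases v) (simp add: algebra_simps)

instance vec :: (finite) finite
proof
  have "(UNIV :: 'a vec set) = (\<lambda>(a, b, c). Vec a b c) ` UNIV"
    by (auto simp: image_iff) (metis vec.exhaust)
  then show "finite (UNIV :: 'a vec set)" by (metis finite_imageI finite)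
qed

text \<open>A linear map with trivial kernel is injective, hence bijective because the space is
  finite; no inverse matrix has to be constructed.\<close>

lemma bij_of_trivial_kernel:
  fixes g :: "'a::{field, finite} vec \<Rightarrow> 'a vec"
  assumes "\<And>k v. g (scale k v) = scale k (g v)" and "\<And>u v. g (vadd u v) = vadd (g u) (g v)"
    and "\<And>v. g v = zero_vec \<Longrightarrow> v = zero_vec"
  shows "bij g"
proof -
  have "inj g"
  proof (rule injI)
    fix u v assume "g u = g v"
    then have "g (vadd u (scale (-1) v)) = zero_vec"
      by (simp add: assms(1,2) vadd_neg_eq_zero_iff)
    then show "u = v" using assms(3) vadd_neg_eq_zero_iff by metis
  qed
  then show ?thesis by (simp add: bij_def finite_UNIV_inj_surj)
qed

lemma dot_eq_zero_imp: "(\<And>v. dot w v = 0) \<Longrightarrow> w = zero_vec"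
proof -
  assume *: "\<And>v. dot w v = 0"
  show ?thesis using *[of "Vec 1 0 0"] *[of "Vec 0 1 0"] *[of "Vec 0 0 1"] by (cases w) simp
qed

text \<open>The set of points satisfying the equation \<open>w\<close> in the new coordinates
  satisfies \<open>?t w\<close> in the old ones. Since the transpose \<open>?t\<close> permutes the
  nonzero vectors, the set of lines stays the same. All projective points still occur, by
  counting.\<close>

lemma coordinates_mat:
  fixes c :: "'b \<Rightarrow> 'a::{field, finite} vec"
  assumes c: "coordinates P L c" and ker: "\<And>v. mat r1 r2 r3 v = zero_vec \<Longrightarrow> v = zero_vec"
  shows "coordinates P L (\<lambda>p. mat r1 r2 r3 (c p))"
proof -
  let ?g = "mat r1 r2 r3" and ?t = "comb r1 r2 r3"
  have nz: "\<And>p. p \<in> P \<Longrightarrow> c p \<noteq> zero_vec" and bij: "bij_betw (\<lambda>p. vnormalize (c p)) P normalized"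
    and L: "L = (\<lambda>w. {p \<in> P. dot w (c p) = 0}) ` {w. w \<noteq> zero_vec}"
    using c by (auto simp: coordinates_def)
  have g: "bij ?g"
    using bij_of_trivial_kernel[of ?g] mat_scale mat_vadd ker by blast
  have g0: "?g v \<noteq> zero_vec" if "v \<noteq> zero_vec" for v using ker that by blast
  have t: "bij ?t"
  proof (rule bij_of_trivial_kernel[OF comb_scale comb_vadd])
    fix w assume "?t w = zero_vec"
    \<comment> \<open>A vector in the kernel of the transpose is orthogonal to the image of
      \<open>?g\<close>, which is the whole space.\<close>
    then have "dot w (?g v) = 0" for v unfolding dot_mat by (cases v) simp
    then have "dot w v = 0" for v using bij_is_surj[OF g] by (metis surjD)
    then show "w = zero_vec" by (rule dot_eq_zero_imp)
  qed
  have t0: "?t w = zero_vec \<longleftrightarrow> w = zero_vec" for w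
  proof -
    have "?t zero_vec = zero_vec" by (cases r1; cases r2; cases r3) simp
    then show ?thesis using bij_is_inj[OF t] by (metis injD)
  qed
  have inj: "inj_on (\<lambda>p. vnormalize (?g (c p))) P"
  proof (rule inj_onI)
    fix p p' assume p: "p \<in> P" "p' \<in> P" and "vnormalize (?g (c p)) = vnormalize (?g (c p'))"
    then obtain k where k: "k \<noteq> 0" "?g (c p) = scale k (?g (c p'))"
      using normalize_eq_iff[OF g0[OF nz] g0[OF nz]] by blast
    then have "?g (c p) = ?g (scale k (c p'))" using mat_scale by metis
    then have "c p = scale k (c p')" using bij_is_inj[OF g] by (metis injD)
    then have "vnormalize (c p) = vnormalize (c p')" using k(1) by (simp add: normalize_scale)
    then show "p = p'" using bij p by (auto simp: bij_betw_def inj_on_def)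
  qed
  moreover have "(\<lambda>p. vnormalize (?g (c p))) ` P = normalized"
  proof (rule card_subset_eq)
    show "(\<lambda>p. vnormalize (?g (c p))) ` P \<subseteq> normalized"
      using g0 nz by (auto simp: normalized_def simp del: mat.simps)
    show "card ((\<lambda>p. vnormalize (?g (c p))) ` P) = card (normalized :: 'a vec set)"
      using card_image[OF inj] bij_betw_same_card[OF bij] by simp
  qed simp
  moreover have "L = (\<lambda>w. {p \<in> P. dot w (?g (c p)) = 0}) ` {w. w \<noteq> zero_vec}"
  proof -
    have "?t ` {w. w \<noteq> zero_vec} = {w. w \<noteq> zero_vec}"
      using bij_is_surj[OF t] t0 by (auto simp del: comb.simps)
    then have "L = (\<lambda>w. {p \<in> P. dot w (c p) = 0}) ` ?t ` {w. w \<noteq> zero_vec}" using L by simp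
    then show ?thesis unfolding image_image dot_mat .
  qed
  ultimately show ?thesis
    using g0 nz by (simp add: coordinates_def bij_betw_def del: mat.simps)
qed

text \<open>The 3 by 3 determinant as a scalar triple product.\<close>

definition det3 :: "'a::field vec \<Rightarrow> 'a vec \<Rightarrow> 'a vec \<Rightarrow> 'a" where
  "det3 u v w = dot (cross u v) w"

text \<open>Cramer's rule.\<close>
lemma cramer:
  "scale (det3 u v w) x = vadd (scale (det3 v w x) u) (vadd (scale (det3 w u x) v) (scale (det3 u v x) w))"
  by (cases u; cases v; cases w; cases x) (simp add: det3_def algebra_simps)

text \<open>By \<open>cramer\<close> the new coordinates of \<open>c p\<close> are its coefficients
  with respect to \<open>u\<close>, \<open>v\<close>, \<open>w\<close>, up to the common determinant
  and the factors \<open>s1\<close>, \<open>s2\<close>, \<open>s3\<close>. Thus \<open>u\<close>,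
  \<open>v\<close>, \<open>w\<close> become multiples of the unit vectors, and the factors remain
  free for a fourth point.\<close>

lemma coordinates_frame:
  fixes c :: "'b \<Rightarrow> 'a::{field, finite} vec"
  assumes c: "coordinates P L c" and d: "det3 u v w \<noteq> 0" and s: "s1 \<noteq> 0" "s2 \<noteq> 0" "s3 \<noteq> 0"
  shows "coordinates P L (\<lambda>p. mat (scale s1 (cross v w)) (scale s2 (cross w u)) (scale s3 (cross u v)) (c p))"
proof (rule coordinates_mat[OF c])
  fix x assume "mat (scale s1 (cross v w)) (scale s2 (cross w u)) (scale s3 (cross u v)) x = zero_vec"
  then have "det3 v w x = 0" "det3 w u x = 0" "det3 u v x = 0"
    using s by (simp_all add: det3_def dot_scale)
  then have "scale (det3 u v w) x = zero_vec"
    unfolding cramer[of u v w x] by (cases u; cases v; cases w) simp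
  then show "x = zero_vec" using d scale_eq_zero_iff by blast
qed

lemma cross_orthogonal: "dot (cross u v) u = 0" "dot (cross u v) v = 0"
  by (cases u; cases v; simp add: algebra_simps)+

lemma cross_eq_zero:
  assumes "u \<noteq> zero_vec" "v \<noteq> zero_vec" "cross u v = zero_vec"
  shows "vnormalize u = vnormalize v"
proof -
  obtain a b c x y z where uv: "u = Vec a b c" "v = Vec x y z" by (cases u; cases v)
  have e: "b * z = c * y" "c * x = a * z" "a * y = b * x" using assms(3) uv by auto
  \<comment> \<open>The vanishing minors force the first nonzero entries into the same position,
    after which all ratios agree.\<close>
  have "a = 0 \<longleftrightarrow> x = 0" using e assms(1,2) uv by auto
  moreover have "b = 0 \<longleftrightarrow> y = 0" if "a = 0" "x = 0" using e assms(1,2) uv that by auto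
  ultimately show ?thesis using e uv by (auto simp: frac_eq_eq mult.commute)
qed

text \<open>The cross product of the first two vectors is the equation of the line through their
  points, nonzero because the points differ. A zero determinant would put the third point on this
  line.\<close>

lemma noncollinear_det3:
  assumes c: "coordinates P L c" and p: "p1 \<in> P" "p2 \<in> P" "p3 \<in> P" "p1 \<noteq> p2"
    and "\<And>l. l \<in> L \<Longrightarrow> p1 \<in> l \<Longrightarrow> p2 \<in> l \<Longrightarrow> p3 \<in> l \<Longrightarrow> False"
  shows "det3 (c p1) (c p2) (c p3) \<noteq> 0"
proof
  assume d: "det3 (c p1) (c p2) (c p3) = 0"
  have nz: "c p1 \<noteq> zero_vec" "c p2 \<noteq> zero_vec"
    and L: "L = (\<lambda>w. {p \<in> P. dot w (c p) = 0}) ` {w. w \<noteq> zero_vec}"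
    and inj: "inj_on (\<lambda>p. vnormalize (c p)) P"
    using c p by (auto simp: coordinates_def bij_betw_def)
  have "cross (c p1) (c p2) \<noteq> zero_vec"
    using cross_eq_zero[OF nz] inj p by (auto simp: inj_on_def)
  then have "{p \<in> P. dot (cross (c p1) (c p2)) (c p) = 0} \<in> L" using L by blast
  then show False
    by (rule assms(6)) (use p d in \<open>auto simp: cross_orthogonal det3_def\<close>)
qed

lemma det3_rotate: "det3 u v w = det3 v w u"
  by (cases u; cases v; cases w) (simp add: det3_def algebra_simps)

lemma det3_degenerate [simp]: "det3 u u w = 0" "det3 u w u = 0" "det3 w u u = 0"
  by (cases u; cases w; simp add: det3_def algebra_simps)+

lemma normalize_unit:
  "s \<noteq> 0 \<Longrightarrow> vnormalize (Vec s 0 0) = Vec 1 0 0"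
  "s \<noteq> 0 \<Longrightarrow> vnormalize (Vec 0 s 0) = Vec 0 1 0"
  "s \<noteq> 0 \<Longrightarrow> vnormalize (Vec 0 0 s) = Vec 0 0 1"
  "s \<noteq> 0 \<Longrightarrow> vnormalize (Vec s s s) = Vec 1 1 1"
  by simp_all

lemma three_point_frame:
  fixes c :: "'b \<Rightarrow> 'a::{field, finite} vec"
  assumes c: "coordinates P L c" and p: "p1 \<in> P" "p2 \<in> P" "p3 \<in> P" "p1 \<noteq> p2"
    and nc: "\<And>l. l \<in> L \<Longrightarrow> p1 \<in> l \<Longrightarrow> p2 \<in> l \<Longrightarrow> p3 \<in> l \<Longrightarrow> False"
  obtains c' :: "'b \<Rightarrow> 'a vec" where "coordinates P L c'"
    "vnormalize (c' p1) = Vec 1 0 0" "vnormalize (c' p2) = Vec 0 1 0" "vnormalize (c' p3) = Vec 0 0 1"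
proof -
  let ?u = "c p1" and ?v = "c p2" and ?w = "c p3"
  have d: "det3 ?u ?v ?w \<noteq> 0" using noncollinear_det3[OF c p nc] .
  then have d': "det3 ?v ?w ?u \<noteq> 0" "det3 ?w ?u ?v \<noteq> 0" using det3_rotate by metis+
  show ?thesis
    using that[OF coordinates_frame[OF c d, of 1 1 1]] d d'
    by (simp add: det3_def[symmetric] normalize_unit del: vnormalize.simps)
qed

lemma four_point_frame:
  fixes c :: "'b \<Rightarrow> 'a::{field, finite} vec"
  assumes c: "coordinates P L c" and p: "p1 \<in> P" "p2 \<in> P" "p3 \<in> P" "p4 \<in> P" "distinct [p1, p2, p3, p4]"
    and nc: "\<And>l x y z. l \<in> L \<Longrightarrow> {x, y, z} \<subseteq> {p1, p2, p3, p4} \<Longrightarrow> distinct [x, y, z] \<Longrightarrow> {x, y, z} \<subseteq> l \<Longrightarrow> False"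
  obtains c' :: "'b \<Rightarrow> 'a vec" where "coordinates P L c'"
    "vnormalize (c' p1) = Vec 1 0 0" "vnormalize (c' p2) = Vec 0 1 0" "vnormalize (c' p3) = Vec 0 0 1"
    "vnormalize (c' p4) = Vec 1 1 1"
proof -
  let ?u = "c p1" and ?v = "c p2" and ?w = "c p3" and ?x = "c p4"
  have det: "det3 (c x) (c y) (c z) \<noteq> 0" if "{x, y, z} \<subseteq> {p1, p2, p3, p4}" "distinct [x, y, z]" for x y z
    by (rule noncollinear_det3[OF c]) (use that p nc[of _ x y z] in auto)
  have d: "det3 ?u ?v ?w \<noteq> 0" "det3 ?v ?w ?x \<noteq> 0" "det3 ?w ?u ?x \<noteq> 0" "det3 ?u ?v ?x \<noteq> 0"
    using p det[of p1 p2 p3] det[of p2 p3 p4] det[of p3 p1 p4] det[of p1 p2 p4] by auto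
  then have d': "det3 ?v ?w ?u \<noteq> 0" "det3 ?w ?u ?v \<noteq> 0" using det3_rotate by metis+
  let ?a = "det3 ?v ?w ?x" and ?b = "det3 ?w ?u ?x" and ?e = "det3 ?u ?v ?x"
  \<comment> \<open>Without factors the fourth point would get the coordinates \<open>?a\<close>,
    \<open>?b\<close>, \<open>?e\<close>. Multiplying each by the product of the other two makes all
    of them equal to their common product, so the point normalises to (1, 1, 1).\<close>
  show ?thesis
    using that[OF coordinates_frame[OF c d(1), of "?b * ?e" "?a * ?e" "?a * ?b"]] d d'
    by (simp add: det3_def[symmetric] dot_scale normalize_unit mult.assoc mult.left_commute mult.commute
        del: vnormalize.simps)
qed

section \<open>Bit strings as names of projective points\<close>

definition labelling :: "'a::field list \<Rightarrow> nat \<Rightarrow> (bool list \<times> 'a vec) list \<Rightarrow> bool" where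
  "labelling els d tb \<longleftrightarrow> set els = UNIV \<and> distinct els \<and> map snd tb = vecs els \<and>
     distinct (map fst tb) \<and> list_all (\<lambda>p. length p = d) (map fst tb)"

lemma set_vecs: "set els = (UNIV :: 'a::field set) \<Longrightarrow> set (vecs els) = (normalized :: 'a vec set)"
proof (intro equalityI subsetI)
  fix v :: "'a vec"
  assume els: "set els = UNIV" and "v \<in> normalized"
  then have "vnormalize v = v" by (simp add: normalized_iff)
  then show "v \<in> set (vecs els)"
    using els by (cases v) (auto simp: image_iff split: if_splits)
qed (auto simp: normalized_iff)

lemma distinct_vecs: "distinct els \<Longrightarrow> distinct (vecs (els :: 'a::field list))"
  by (auto simp: distinct_map distinct_product inj_on_def)

lemma labellingD:
  assumes "labelling els d tb"
  shows "set (map snd tb) = normalized" "distinct (map snd tb)" "distinct (map fst tb)"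
    "\<And>p. p \<in> set (points_of tb) \<Longrightarrow> length p = d"
  using assms set_vecs distinct_vecs
  by (auto simp: labelling_def list_all_iff points_of_def simp del: vecs.simps)

lemma code_mem: "v \<in> set (map snd tb) \<Longrightarrow> (code tb v, v) \<in> set tb"
proof (induction tb)
  case (Cons a tb)
  obtain p w where "a = (p, w)" by (cases a)
  then show ?case using Cons by (cases "w = v") auto
qed simp

lemma set_perp: "set (perp w tb) = {p. \<exists>v. (p, v) \<in> set tb \<and> dot w v = 0}"
  by (induction w tb rule: perp.induct) (auto simp: set_keep)

lemma set_perps: "set (perps ws tb) = (\<lambda>w. mktrie (perp w tb)) ` set ws"
  by (induction ws tb rule: perps.induct) auto

context
  fixes els :: "'a::field list" and d :: nat and tb :: "(bool list \<times> 'a vec) list"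
  assumes lab: "labelling els d tb"
begin

lemma code_in: "v \<in> normalized \<Longrightarrow> (code tb v, v) \<in> set tb"
  using code_mem labellingD(1)[OF lab] by metis

lemma code_eq: "(p, v) \<in> set tb \<Longrightarrow> code tb v = p"
proof -
  assume p: "(p, v) \<in> set tb"
  then have "v \<in> set (map snd tb)" by force
  then have "(code tb v, v) \<in> set tb" by (rule code_mem)
  then show ?thesis
    using p labellingD(2)[OF lab] by (metis distinct_map inj_onD prod.inject snd_conv)
qed

lemma bij_code: "bij_betw (code tb) normalized (set (points_of tb))"
  unfolding bij_betw_def points_of_def
proof
  show "inj_on (code tb) normalized"
  proof (rule inj_onI)
    fix u v assume "u \<in> normalized" "v \<in> normalized" "code tb u = code tb v"
    then have "(code tb u, u) \<in> set tb" "(code tb u, v) \<in> set tb"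
      using code_in[of u] code_in[of v] by simp_all
    then show "u = v"
      using labellingD(3)[OF lab] by (metis distinct_map inj_onD prod.inject fst_conv)
  qed
  show "code tb ` normalized = set (map fst tb)"
  proof (intro equalityI subsetI)
    fix p assume "p \<in> set (map fst tb)"
    then obtain v where v: "(p, v) \<in> set tb" by auto
    then have "v \<in> set (map snd tb)" by force
    then have "v \<in> normalized" by (simp only: labellingD(1)[OF lab])
    then show "p \<in> code tb ` normalized" using code_eq[OF v] by (intro image_eqI[of p _ v]) simp_all
  qed (use code_in in force)
qed

lemma pts_perp: "pts (mktrie (perp w tb)) = code tb ` {v \<in> normalized. dot w v = 0}"
proof -
  have len: "length p = d" if "p \<in> set (perp w tb)" for p
  proof -
    have "p \<in> set (points_of tb)" using that by (force simp: set_perp points_of_def)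
    then show ?thesis by (rule labellingD(4)[OF lab])
  qed
  have "set (perp w tb) = code tb ` {v \<in> normalized. dot w v = 0}"
  proof (intro equalityI subsetI)
    fix p assume "p \<in> set (perp w tb)"
    then obtain v where v: "(p, v) \<in> set tb" "dot w v = 0" by (auto simp: set_perp)
    then have "v \<in> set (map snd tb)" by force
    then have "v \<in> normalized" by (simp only: labellingD(1)[OF lab])
    then show "p \<in> code tb ` {v \<in> normalized. dot w v = 0}"
      using code_eq[OF v(1)] v(2) by (intro image_eqI[of p _ v]) simp_all
  next
    fix p assume "p \<in> code tb ` {v \<in> normalized. dot w v = 0}"
    then obtain v where "v \<in> normalized" "dot w v = 0" "p = code tb v" by auto
    then show "p \<in> set (perp w tb)" using code_in[of v] by (auto simp: set_perp)
  qed
  then show ?thesis using mktrie_correct[of "perp w tb" d] len by simp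
qed

lemma pts_lines: "pts ` set (lines_of tb) = (\<lambda>w. code tb ` {v \<in> normalized. dot w v = 0}) ` {w. w \<noteq> zero_vec}"
proof -
  have "pts ` set (lines_of tb) = (\<lambda>w. code tb ` {v \<in> normalized. dot w v = 0}) ` set (map snd tb)"
    unfolding lines_of_def set_perps image_image pts_perp ..
  also have "\<dots> = (\<lambda>w. code tb ` {v \<in> normalized. dot w v = 0}) ` vnormalize ` {w. w \<noteq> zero_vec}"
    unfolding labellingD(1)[OF lab] normalized_def ..
  also have "\<dots> = (\<lambda>w. code tb ` {v \<in> normalized. dot w v = 0}) ` {w. w \<noteq> zero_vec}"
    unfolding image_image by (intro image_cong refl) (simp add: dot_normalize_eq_zero_iff(2))
  finally show ?thesis .
qed

text \<open>Transfers a plane with coordinates to the encoded plane on which the search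
  operates.\<close>

lemma coordinates_code:
  assumes "coordinates P L c"
  defines "f \<equiv> \<lambda>p. code tb (vnormalize (c p))"
  shows "bij_betw f P (set (points_of tb))" and "(\<lambda>l. f ` l) ` L = pts ` set (lines_of tb)"
proof -
  have c: "\<And>p. p \<in> P \<Longrightarrow> c p \<noteq> zero_vec" "bij_betw (\<lambda>p. vnormalize (c p)) P normalized"
    "L = (\<lambda>w. {p \<in> P. dot w (c p) = 0}) ` {w. w \<noteq> zero_vec}"
    using assms(1) by (auto simp: coordinates_def)
  show "bij_betw f P (set (points_of tb))"
    using bij_betw_trans[OF c(2) bij_code] by (simp add: f_def comp_def)
  have "(\<lambda>p. vnormalize (c p)) ` {p \<in> P. dot w (c p) = 0} = {v \<in> normalized. dot w v = 0}" for w
  proof -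
    have "(\<lambda>p. vnormalize (c p)) ` {p \<in> P. dot w (c p) = 0}
        = {v \<in> (\<lambda>p. vnormalize (c p)) ` P. dot w v = 0}"
      using c(1) by (auto simp: dot_normalize_eq_zero_iff(1))
    then show ?thesis using bij_betw_imp_surj_on[OF c(2)] by simp
  qed
  then have "f ` {p \<in> P. dot w (c p) = 0} = code tb ` {v \<in> normalized. dot w v = 0}" for w
    unfolding f_def by (metis (no_types) image_image)
  then show "(\<lambda>l. f ` l) ` L = pts ` set (lines_of tb)"
    unfolding pts_lines c(3) image_image by simp
qed

text \<open>Holds for any labelling, in particular for relabelled tables; it shows that the
  witnesses for the lower bounds are copies of PG(2,q).\<close>

lemma coordinates_table:
  "coordinates (set (points_of tb)) (pts ` set (lines_of tb)) (the_inv_into normalized (code tb))"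
proof -
  let ?c = "the_inv_into normalized (code tb)"
  have inj: "inj_on (code tb) normalized" and V: "set (points_of tb) = code tb ` normalized"
    using bij_code by (auto simp: bij_betw_def)
  have c: "?c (code tb v) = v" if "v \<in> normalized" for v
    using the_inv_into_f_f[OF inj that] .
  have mem: "?c p \<in> normalized" if "p \<in> set (points_of tb)" for p
    using that c V by auto
  have "vnormalize (?c p) = ?c p" if "p \<in> set (points_of tb)" for p
    using mem[OF that] by (simp add: normalized_iff)
  then have "bij_betw (\<lambda>p. vnormalize (?c p)) (set (points_of tb)) normalized"
    using bij_betw_the_inv_into[OF bij_code] by (subst bij_betw_cong[of _ _ ?c]) auto
  moreover have "code tb ` {v \<in> normalized. dot w v = 0} = {p \<in> set (points_of tb). dot w (?c p) = 0}" for w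
    unfolding V using c by auto
  moreover have "\<forall>p\<in>set (points_of tb). ?c p \<noteq> zero_vec"
    using mem normalize_nonzero by (metis normalized_iff)
  ultimately show ?thesis
    unfolding coordinates_def pts_lines by simp
qed

end

section \<open>The scheduled steps offer all possible lines\<close>

lemma set_inside: "set (inside m ys) = set ys \<inter> pts m"
  by (induction ys) (auto simp: set_keep mem_iff)

lemma distinct_inside: "distinct ys \<Longrightarrow> distinct (inside m ys)"
proof (induction ys)
  case (Cons y ys)
  then show ?case by (cases "mem m y") (auto simp: set_inside)
qed simp

text \<open>\<open>T\<close> must contain every (q+1)-arc that could be the line joining
  \<open>x\<close> and a point of \<open>ys\<close>. Plane 0 is special, since it has
  \<open>m\<close> as a line: its other lines meet \<open>m\<close> only once, so fewer candidates
  are required.\<close>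

fun good_step :: "trie list \<Rightarrow> bool list set \<Rightarrow> nat \<Rightarrow> trie \<Rightarrow> step \<Rightarrow> bool" where
  "good_step A V q m (i, x, ys, T) \<longleftrightarrow> x \<in> V \<and> set ys \<subseteq> V - {x} \<and>
     (\<forall>y\<in>set ys. \<forall>l. is_arc A l \<longrightarrow> l \<subseteq> V \<longrightarrow> card l = q + 1 \<longrightarrow> x \<in> l \<longrightarrow> y \<in> l \<longrightarrow>
        (i = 0 \<longrightarrow> card (l \<inter> pts m) \<le> 1) \<longrightarrow> l \<in> pts ` set T)"

context
  fixes A :: "trie list" and V :: "bool list list" and d q :: nat and m :: trie
  assumes len: "\<And>p. p \<in> set V \<Longrightarrow> length p = d"
begin

text \<open>For \<open>x\<close> on \<open>m\<close>, an arc through \<open>x\<close> with at most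
  one point on \<open>m\<close> has its q other points off \<open>m\<close>, so these may be drawn
  from \<open>outside m V\<close>.\<close>

lemma good_pencil_step:
  assumes "x \<in> set V" "x \<in> pts m"
  shows "good_step A (set V) q m (pencil_step A q 0 x ts (outside m V))"
proof -
  have "l \<in> pts ` set (arcs A q [x] (outside m V))"
    if "is_arc A l" "l \<subseteq> set V" "card l = q + 1" "x \<in> l" "card (l \<inter> pts m) \<le> 1" for l
  proof (rule arcs_complete[where n = d])
    have "finite l" using that(1) by (simp add: is_arc_def)
    then have "y = x" if "y \<in> l \<inter> pts m" for y
      using that \<open>card (l \<inter> pts m) \<le> 1\<close> \<open>x \<in> l\<close> assms(2) by (auto simp: card_le_Suc0_iff_eq)
    then show "l \<subseteq> set [x] \<union> set (outside m V)"
      using that(2) by (auto simp: set_outside)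
  qed (use that len in auto)
  then show ?thesis using assms by (auto simp: set_on_lines set_off_lines set_outside)
qed

lemma good_plane_step:
  assumes "x \<in> set V"
  shows "good_step A (set V) q m (pencil_step A q i x ts (outside (mktrie [x]) V))"
proof -
  have x: "pts (mktrie [x]) = {x}" using mktrie_correct[of "[x]" d] len assms by simp
  have "l \<in> pts ` set (arcs A q [x] (outside (mktrie [x]) V))"
    if "is_arc A l" "l \<subseteq> set V" "card l = q + 1" "x \<in> l" for l
    by (rule arcs_complete[where n = d]) (use that x len in \<open>auto simp: set_outside simp del: mktrie.simps\<close>)
  then show ?thesis using assms x by (auto simp: set_on_lines set_off_lines set_outside simp del: mktrie.simps)
qed

lemma good_pair_steps:
  assumes "x \<in> set V" "set ys \<subseteq> set V - {x}" "q = Suc k" "s \<in> set (pair_steps A k i x V ys)"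
  shows "good_step A (set V) q m s"
proof -
  obtain y where y: "y \<in> set ys" "s = (i, x, [y], arcs A k [y, x] V)"
    using assms(4) by (induction ys) auto
  have "l \<in> pts ` set (arcs A k [y, x] V)"
    if "is_arc A l" "l \<subseteq> set V" "card l = q + 1" "x \<in> l" "y \<in> l" for l
  proof (rule arcs_complete[where n = d])
    have "y \<noteq> x" using y assms(2) by auto
    then show "card l = k + card (set [y, x])" using that(3) assms(3) by simp
  qed (use that len in auto)
  then show ?thesis using assms y by auto
qed

lemma good_pencil_steps:
  assumes "set xs \<subseteq> set V \<inter> pts m" "s \<in> set (pencil_steps A q m xs (outside m V))"
  shows "good_step A (set V) q m s"
  using assms by (induction xs) (auto simp del: pencil_step.simps simp: good_pencil_step)

lemma good_all_plane_steps:
  assumes "set xs \<subseteq> set V" "s \<in> set (all_plane_steps A q V xs is)"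
  shows "good_step A (set V) q m s"
proof -
  obtain i where "s \<in> set (plane_steps A q i V xs)"
    using assms(2) by (induction "is") auto
  then show ?thesis
    using assms(1) by (induction xs) (auto simp del: pencil_step.simps mktrie.simps simp: good_plane_step)
qed

lemma good_mixed_steps:
  assumes "set xs \<subseteq> set V \<inter> pts m" "distinct (xs @ prev)" "set prev \<subseteq> set V" "q = Suc k"
    "s \<in> set (mixed_steps A k V m (outside m V) prev xs)"
  shows "good_step A (set V) q m s"
  using assms
proof (induction xs arbitrary: prev)
  case (Cons x xs)
  then consider "s = pencil_step A (Suc k) 0 x (tangents m (incident A x)) (outside m V)"
    | "s \<in> set (pair_steps A k (Suc 0) x V prev)"
    | "s \<in> set (mixed_steps A k V m (outside m V) (x # prev) xs)" by auto
  then show ?case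
  proof cases
    case 1
    then show ?thesis using good_pencil_step[of x] Cons.prems by simp
  next
    case 2
    show ?thesis by (rule good_pair_steps[OF _ _ Cons.prems(4) 2]) (use Cons.prems in auto)
  next
    case 3
    then show ?thesis using Cons.IH[of "x # prev"] Cons.prems by auto
  qed
qed simp

end

lemma index_pencil_steps: "(i, x, ys, T) \<in> set (pencil_steps A q m xs off) \<Longrightarrow> i = 0"
  by (induction xs) auto

lemma index_all_plane_steps: "(i, x, ys, T) \<in> set (all_plane_steps A q V xs is) \<Longrightarrow> i \<in> set is"
proof (induction "is")
  case (Cons j "is")
  have "i = j" if "(i, x, ys, T) \<in> set (plane_steps A q j V xs)"
    using that by (induction xs) auto
  then show ?case using Cons by auto
qed simp

lemma index_mixed_steps: "(i, x, ys, T) \<in> set (mixed_steps A k V m off prev xs) \<Longrightarrow> i < 2"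
proof (induction xs arbitrary: prev)
  case (Cons z xs)
  have "i = Suc 0" if "(i, x, ys, T) \<in> set (pair_steps A k (Suc 0) z V prev)"
    using that by (induction prev) auto
  then show ?case using Cons by auto
qed simp

section \<open>Orthogoval planes survive the search\<close>

lemma projective_plane_card_Int:
  assumes "projective_plane P L q" "l \<in> L" "m \<in> L" "l \<noteq> m"
  shows "card (l \<inter> m) = 1"
proof -
  interpret projective_plane P L q by fact
  obtain x where "x \<in> P" "x \<in> l" "x \<in> m" "\<And>y. y \<in> P \<Longrightarrow> y \<in> l \<Longrightarrow> y \<in> m \<Longrightarrow> y = x"
    using unique_point[OF assms(2-4)] by blast
  then have "l \<inter> m = {x}" using lines_subset[OF assms(2)] by blast
  then show ?thesis by simp
qed

text \<open>\<open>L\<close> is the reference plane and \<open>Ls\<close> lists the others. The code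
  map is injective and so preserves intersection sizes; it turns the lines of \<open>Ls\<close> into
  (q+1)-arcs of the encoded plane that satisfy the hypotheses of
  \<open>search_complete\<close>.\<close>

lemma search_nonempty:
  fixes c :: "'b \<Rightarrow> 'a::field vec"
  assumes lab: "labelling els d tb" and c: "coordinates P L c"
    and Ls: "\<And>i. i < length Ls \<Longrightarrow> projective_plane P (Ls ! i) q"
    and orth: "\<And>i. i < length Ls \<Longrightarrow> orthogoval L (Ls ! i)"
      "\<And>i j. i < length Ls \<Longrightarrow> j < length Ls \<Longrightarrow> i \<noteq> j \<Longrightarrow> orthogoval (Ls ! i) (Ls ! j)"
    and l0: "0 < length Ls" "l0 \<in> Ls ! 0" "(\<lambda>p. code tb (vnormalize (c p))) ` l0 = pts m"
    and steps: "\<And>s. s \<in> set ps \<Longrightarrow> good_step (lines_of tb) (set (points_of tb)) q m s"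
      "\<And>i x ys T. (i, x, ys, T) \<in> set ps \<Longrightarrow> i < length Ls"
  shows "search ps ([m] # replicate (length Ls - 1) []) \<noteq> []"
proof -
  define f where "f p = code tb (vnormalize (c p))" for p
  define Ds where "Ds = map ((`) ((`) f)) Ls"
  let ?V = "set (points_of tb)" and ?st = "[m] # replicate (length Ls - 1) []"
  have bij: "bij_betw f P ?V" and L: "(`) f ` L = pts ` set (lines_of tb)"
    using coordinates_code[OF lab c] by (simp_all add: f_def[abs_def])
  have inj: "inj_on f P" and fP: "f ` P = ?V" using bij by (auto simp: bij_betw_def)
  have LP: "l \<subseteq> P" if "l \<in> L" for l using c that by (auto simp: coordinates_def)
  have DP: "l \<subseteq> P" if "i < length Ls" "l \<in> Ls ! i" for i l
    using projective_plane.lines_subset[OF Ls[OF that(1)] that(2)] .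
  have card_f: "card (f ` l \<inter> f ` k) = card (l \<inter> k)" if "l \<subseteq> P" "k \<subseteq> P" for l k
    using that inj by (simp add: inj_on_image_Int[OF inj that, symmetric] card_image[OF inj_on_subset[OF inj]] le_infI1)
  have Ds_nth: "Ds ! i = (`) f ` (Ls ! i)" if "i < length Ls" for i using that by (simp add: Ds_def)
  have arc: "is_arc (lines_of tb) (f ` l)" "f ` l \<subseteq> ?V" "card (f ` l) = q + 1"
    if il: "i < length Ls" "l \<in> Ls ! i" for i l
  proof -
    have card_l: "card l = q + 1" using projective_plane.card_line[OF Ls] il by blast
    show "card (f ` l) = q + 1" using card_image[OF inj_on_subset[OF inj DP[OF il]]] card_l by simp
    show "f ` l \<subseteq> ?V" using DP[OF il] fP by auto
    have "card (f ` l \<inter> pts t) \<le> 2" if "t \<in> set (lines_of tb)" for t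
    proof -
      have "pts t \<in> (`) f ` L" using that L by simp
      then obtain k where k: "k \<in> L" "pts t = f ` k" by auto
      then have "card (k \<inter> l) \<le> 2" using orth(1)[OF il(1)] il(2) by (auto simp: orthogoval_def)
      then show ?thesis using card_f[OF DP[OF il] LP[OF k(1)]] k(2) by (simp add: Int_commute)
    qed
    moreover have "finite (f ` l)" using card_l by (intro finite_imageI card_ge_0_finite) simp
    ultimately show "is_arc (lines_of tb) (f ` l)" by (simp add: is_arc_def)
  qed
  have lin: "partial_linear (Ds ! i)" if i: "i < length Ls" for i
    unfolding partial_linear_def Ds_nth[OF i]
  proof (intro ballI impI)
    fix l' k' assume "l' \<in> (`) f ` (Ls ! i)" "k' \<in> (`) f ` (Ls ! i)" "l' \<noteq> k'"
    then obtain l k where lk: "l \<in> Ls ! i" "k \<in> Ls ! i" "l' = f ` l" "k' = f ` k" "l \<noteq> k" by blast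
    then show "card (l' \<inter> k') \<le> 1"
      using projective_plane_card_Int[OF Ls[OF i] lk(1,2,5)] card_f[OF DP[OF i lk(1)] DP[OF i lk(2)]] by simp
  qed
  show ?thesis
  proof (rule search_complete[of Ds])
    show "partial_linear (Ds ! i)" if "i < length Ds" for i using lin that by (simp add: Ds_def)
    show "card (l \<inter> k) \<le> 2" if h: "i < length Ds" "j < length Ds" "i \<noteq> j" "l \<in> Ds ! i" "k \<in> Ds ! j" for i j l k
    proof -
      have ij: "i < length Ls" "j < length Ls" using h by (simp_all add: Ds_def)
      obtain l' k' where lk: "l' \<in> Ls ! i" "l = f ` l'" "k' \<in> Ls ! j" "k = f ` k'"
        using h(4,5) Ds_nth ij by auto
      have "card (l' \<inter> k') \<le> 2" using orth(2)[OF ij h(3)] lk by (auto simp: orthogoval_def)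
      then show ?thesis using card_f[OF DP[OF ij(1) lk(1)] DP[OF ij(2) lk(3)]] lk by simp
    qed
    show "length ?st = length Ds" using l0(1) by (simp add: Ds_def)
    show st: "pts ` set (?st ! i) \<subseteq> Ds ! i" if "i < length Ds" for i
    proof (cases i)
      case 0
      then show ?thesis using l0 Ds_nth[of 0] by (auto simp: f_def[symmetric])
    next
      case (Suc j)
      then show ?thesis using that by (simp add: Ds_def)
    qed
    show "valid_step Ds ?st s" if s: "s \<in> set ps" for s
    proof -
      obtain i x ys T where s_eq: "s = (i, x, ys, T)" by (cases s)
      have i: "i < length Ls" using steps(2) s s_eq by blast
      have g: "x \<in> ?V" "set ys \<subseteq> ?V - {x}"
        "\<And>y l. y \<in> set ys \<Longrightarrow> is_arc (lines_of tb) l \<Longrightarrow> l \<subseteq> ?V \<Longrightarrow> card l = q + 1 \<Longrightarrow> x \<in> l \<Longrightarrow> y \<in> l \<Longrightarrow>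
          (i = 0 \<Longrightarrow> card (l \<inter> pts m) \<le> 1) \<Longrightarrow> l \<in> pts ` set T"
        using steps(1)[OF s] s_eq by auto
      have "\<exists>l\<in>Ds ! i. x \<in> l \<and> y \<in> l" if y: "y \<in> set ys" for y
      proof -
        have "x \<in> f ` P" "y \<in> f ` P" using g(1,2) y fP by auto
        then obtain x' y' where xy: "x' \<in> P" "y' \<in> P" "x = f x'" "y = f y'" by blast
        then have "x' \<noteq> y'" using g(2) y by auto
        then obtain l where "l \<in> Ls ! i" "x' \<in> l" "y' \<in> l"
          using projective_plane.unique_line[OF Ls[OF i] xy(1,2)] by blast
        then show ?thesis using Ds_nth[OF i] xy by auto
      qed
      moreover have "l \<in> pts ` set T"
        if y: "y \<in> set ys" and l: "l \<in> Ds ! i" "x \<in> l" "y \<in> l" "l \<notin> pts ` set (?st ! i)" for y l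
      proof -
        obtain l' where l': "l' \<in> Ls ! i" "l = f ` l'" using l(1) Ds_nth[OF i] by auto
        \<comment> \<open>A line of plane 0 that is not yet known at the start differs from
          \<open>m\<close>, hence meets it in one point.\<close>
        have "card (l \<inter> pts m) \<le> 1" if "i = 0"
        proof -
          have "l \<noteq> pts m" using l(4) that by auto
          moreover have "pts m \<in> Ds ! 0" using st[of 0] l0(1) by (simp add: Ds_def)
          ultimately show ?thesis using lin[OF i] l(1) that by (auto simp: partial_linear_def)
        qed
        then show ?thesis by (rule g(3)[OF y arc[OF i l'(1), folded l'(2)] l(2,3)])
      qed
      ultimately show ?thesis using i by (simp add: s_eq Ds_def)
    qed
  qed
qed

section \<open>The fields of orders 2, 3, 4 and 5\<close>

text \<open>\<open>isomorphic_to_PG2\<close> asks for a field realised on natural numbers; the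
  operations of the field type are transported along an injection into \<open>nat\<close>.\<close>

lemma nat_field_copy:
  obtains F :: "nat ring" and h :: "'a::{field, finite} \<Rightarrow> nat"
  where "field F" "order F = card (UNIV :: 'a set)" "field_iso F h"
proof -
  obtain h :: "'a \<Rightarrow> nat" where h: "inj h" using finite_imp_inj_to_nat_seg[of "UNIV :: 'a set"] by auto
  define g where "g = the_inv h"
  have gh [simp]: "g (h a) = a" for a unfolding g_def using h by (simp add: the_inv_f_f)
  define F :: "nat ring" where "F = \<lparr>carrier = range h, monoid.mult = \<lambda>x y. h (g x * g y), one = h 1,
     zero = h 0, add = \<lambda>x y. h (g x + g y)\<rparr>"
  have iso: "field_iso F h"
    using h by (simp add: field_iso_def bij_betw_def F_def)
  have "abelian_group F"
  proof (rule abelian_groupI)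
    fix x assume "x \<in> carrier F"
    then obtain a where "x = h a" by (auto simp: F_def)
    then show "\<exists>y\<in>carrier F. y \<oplus>\<^bsub>F\<^esub> x = \<zero>\<^bsub>F\<^esub>" by (intro bexI[of _ "h (- a)"]) (auto simp: F_def)
  qed (auto simp: F_def algebra_simps)
  moreover have "comm_monoid F"
    by (rule comm_monoidI) (auto simp: F_def algebra_simps)
  ultimately have "cring F" by (rule cringI) (auto simp: F_def algebra_simps)
  then have "field F"
  proof (rule cring.cring_fieldI)
    show "Units F = carrier F - {\<zero>\<^bsub>F\<^esub>}"
    proof (intro equalityI subsetI)
      fix x assume "x \<in> Units F"
      then show "x \<in> carrier F - {\<zero>\<^bsub>F\<^esub>}"
        using h by (auto simp: Units_def F_def inj_eq)
    next
      fix x assume "x \<in> carrier F - {\<zero>\<^bsub>F\<^esub>}"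
      then obtain a where "x = h a" "a \<noteq> 0" by (auto simp: F_def)
      then show "x \<in> Units F" unfolding Units_def F_def
        by (auto intro!: exI[of _ "inverse a"])
    qed
  qed
  moreover have "order F = card (UNIV :: 'a set)" using h by (simp add: order_def F_def card_image)
  ultimately show ?thesis using that iso by blast
qed

text \<open>The additive order of \<one> divides the prime \<open>p\<close> and is not 1, so the
  multiples of \<one> exhaust the field and are added and multiplied as residues modulo
  \<open>p\<close>. The map \<open>rep\<close> reads the elements of the concrete type as
  residues.\<close>

lemma (in field) prime_field_iso:
  fixes rep :: "'k::field \<Rightarrow> nat"
  assumes p: "order R = p" "prime p"
    and rep: "rep 0 = 0" "rep 1 = 1" "\<And>a b. rep (a + b) = (rep a + rep b) mod p"
      "\<And>a b. rep (a * b) = (rep a * rep b) mod p" "bij_betw rep UNIV {..<p}"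
  shows "field_iso R (\<lambda>a. [(rep a)] \<cdot> \<one>)"
proof -
  have ord: "add.ord \<one> = p"
  proof -
    have "add.ord \<one> dvd p"
      using add.ord_dvd_group_order[of \<one>] p(1) by (simp add: order_def)
    moreover have "add.ord \<one> \<noteq> 1"
      using add.ord_eq_1[of \<one>] one_not_zero by simp
    ultimately show ?thesis using p(2) by (auto simp: prime_nat_iff)
  qed
  have zero_iff: "[n] \<cdot> \<one> = \<zero> \<longleftrightarrow> p dvd n" for n :: nat
    using add.pow_eq_id[of \<one> n] ord by simp
  have add: "[(m + n)] \<cdot> \<one> = [m] \<cdot> \<one> \<oplus> [n] \<cdot> \<one>" for m n :: nat
    by (simp add: add.nat_pow_mult)
  have mod_p: "[(n mod p)] \<cdot> \<one> = [n] \<cdot> \<one>" for n :: nat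
  proof -
    have "[n] \<cdot> \<one> = [(n div p * p)] \<cdot> \<one> \<oplus> [(n mod p)] \<cdot> \<one>" by (simp flip: add)
    moreover have "[(n div p * p)] \<cdot> \<one> = \<zero>" unfolding zero_iff by simp
    ultimately show ?thesis by simp
  qed
  have "i = j" if "i < p" "j < p" "[i] \<cdot> \<one> = [j] \<cdot> \<one>" "i \<le> j" for i j :: nat
  proof -
    have "[i] \<cdot> \<one> \<oplus> [(j - i)] \<cdot> \<one> = [i] \<cdot> \<one> \<oplus> \<zero>"
      using add[of i "j - i"] that by simp
    then have "[(j - i)] \<cdot> \<one> = \<zero>" by simp
    then have "p dvd j - i" using zero_iff by blast
    then have "j - i = 0 \<or> p \<le> j - i" by (metis dvd_imp_le gr0I)
    then show "i = j" using that by linarith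
  qed
  then have "inj_on (\<lambda>n :: nat. [n] \<cdot> \<one>) {..<p}"
    by (intro inj_onI) (metis lessThan_iff nat_le_linear)
  moreover then have "(\<lambda>n :: nat. [n] \<cdot> \<one>) ` {..<p} = carrier R"
    using p by (intro card_subset_eq) (auto simp: card_image order_def intro: card_ge_0_finite prime_gt_0_nat)
  ultimately have "bij_betw (\<lambda>n :: nat. [n] \<cdot> \<one>) {..<p} (carrier R)"
    by (simp add: bij_betw_def)
  then have "bij_betw (\<lambda>a. [(rep a)] \<cdot> \<one>) UNIV (carrier R)"
    using bij_betw_trans[OF rep(5)] by (force simp: comp_def)
  moreover have "[(m * n)] \<cdot> \<one> = [m] \<cdot> \<one> \<otimes> [n] \<cdot> \<one>" for m n :: nat
  proof -
    have "[m] \<cdot> \<one> \<otimes> [n] \<cdot> \<one> = [m] \<cdot> ([n] \<cdot> \<one>)" by (simp add: add_pow_ldistr)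
    then show ?thesis by (simp add: add.nat_pow_pow mult.commute)
  qed
  ultimately show ?thesis
    unfolding field_iso_def by (simp add: rep mod_p add)
qed

text \<open>Enumerated types with explicit operation tables, on which arithmetic is evaluated by
  rewriting and the field axioms are verified by cases.\<close>

datatype gf2 = A0 | A1
datatype gf3 = B0 | B1 | B2
datatype gf4 = C0 | C1 | C2 | C3
datatype gf5 = D0 | D1 | D2 | D3 | D4

instantiation gf2 :: field begin
definition "0 = A0" definition "1 = A1"
fun plus_gf2 where "A0 + b = (b::gf2)" | "A1 + A0 = A1" | "A1 + A1 = A0"
fun times_gf2 where "A0 * b = (A0::gf2)" | "A1 * b = b"
fun uminus_gf2 where "- (a::gf2) = a"
fun minus_gf2 where "(a::gf2) - b = a + - b"
fun inverse_gf2 where "inverse (a::gf2) = a"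
fun divide_gf2 where "(a::gf2) div b = a * inverse b"
instance proof
  fix a b c :: gf2
  note d = zero_gf2_def one_gf2_def
  show "a + b + c = a + (b + c)" by (cases a; cases b; cases c) simp_all
  show "a + b = b + a" by (cases a; cases b) simp_all
  show "0 + a = a" by (cases a) (simp_all add: d)
  show "- a + a = 0" by (cases a) (simp_all add: d)
  show "a - b = a + - b" by (cases a; cases b) simp_all
  show "a * b * c = a * (b * c)" by (cases a; cases b; cases c) simp_all
  show "a * b = b * a" by (cases a; cases b) simp_all
  show "1 * a = a" by (cases a) (simp_all add: d)
  show "(a + b) * c = a * c + b * c" by (cases a; cases b; cases c) simp_all
  show "(0::gf2) \<noteq> 1" by (simp add: d)
  show "a \<noteq> 0 \<Longrightarrow> inverse a * a = 1" by (cases a) (simp_all add: d)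
  show "a div b = a * inverse b" by simp
  show "inverse (0::gf2) = 0" by (simp add: d)
qed
end

instantiation gf3 :: field begin
definition "0 = B0" definition "1 = B1"
fun plus_gf3 where "B0 + b = (b::gf3)" | "B1 + B0 = B1" | "B1 + B1 = B2" | "B1 + B2 = B0" | "B2 + B0 = B2" | "B2 + B1 = B0" | "B2 + B2 = B1"
fun uminus_gf3 where "- B0 = B0" | "- B1 = B2" | "- B2 = B1"
fun times_gf3 where "B0 * b = (B0::gf3)" | "B1 * b = b" | "B2 * b = - b"
fun minus_gf3 where "(a::gf3) - b = a + - b"
fun inverse_gf3 where "inverse (a::gf3) = a"
fun divide_gf3 where "(a::gf3) div b = a * inverse b"
instance proof
  fix a b c :: gf3
  note d = zero_gf3_def one_gf3_def
  show "a + b + c = a + (b + c)" by (cases a; cases b; cases c) simp_all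
  show "a + b = b + a" by (cases a; cases b) simp_all
  show "0 + a = a" by (cases a) (simp_all add: d)
  show "- a + a = 0" by (cases a) (simp_all add: d)
  show "a - b = a + - b" by (cases a; cases b) simp_all
  show "a * b * c = a * (b * c)" by (cases a; cases b; cases c) simp_all
  show "a * b = b * a" by (cases a; cases b) simp_all
  show "1 * a = a" by (cases a) (simp_all add: d)
  show "(a + b) * c = a * c + b * c" by (cases a; cases b; cases c) simp_all
  show "(0::gf3) \<noteq> 1" by (simp add: d)
  show "a \<noteq> 0 \<Longrightarrow> inverse a * a = 1" by (cases a) (simp_all add: d)
  show "a div b = a * inverse b" by simp
  show "inverse (0::gf3) = 0" by (simp add: d)
qed
end

text \<open>\<open>C2\<close> is a root of X^2 + X + 1, and \<open>C3\<close> is both its square and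
  \<open>C1 + C2\<close>.\<close>

instantiation gf4 :: field begin
definition "0 = C0" definition "1 = C1"
fun plus_gf4 where "C0 + b = (b::gf4)" | "C1 + C0 = C1" | "C1 + C1 = C0" | "C1 + C2 = C3" | "C1 + C3 = C2"
 | "C2 + C0 = C2" | "C2 + C1 = C3" | "C2 + C2 = C0" | "C2 + C3 = C1" | "C3 + C0 = C3" | "C3 + C1 = C2" | "C3 + C2 = C1" | "C3 + C3 = C0"
fun uminus_gf4 where "- (a::gf4) = a"
fun times_gf4 where "C0 * b = (C0::gf4)" | "C1 * b = b" | "C2 * C0 = C0" | "C2 * C1 = C2" | "C2 * C2 = C3" | "C2 * C3 = C1"
 | "C3 * C0 = C0" | "C3 * C1 = C3" | "C3 * C2 = C1" | "C3 * C3 = C2"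
fun minus_gf4 where "(a::gf4) - b = a + - b"
fun inverse_gf4 where "inverse C0 = C0" | "inverse C1 = C1" | "inverse C2 = C3" | "inverse C3 = C2"
fun divide_gf4 where "(a::gf4) div b = a * inverse b"
instance proof
  fix a b c :: gf4
  note d = zero_gf4_def one_gf4_def
  show "a + b + c = a + (b + c)" by (cases a; cases b; cases c) simp_all
  show "a + b = b + a" by (cases a; cases b) simp_all
  show "0 + a = a" by (cases a) (simp_all add: d)
  show "- a + a = 0" by (cases a) (simp_all add: d)
  show "a - b = a + - b" by (cases a; cases b) simp_all
  show "a * b * c = a * (b * c)" by (cases a; cases b; cases c) simp_all
  show "a * b = b * a" by (cases a; cases b) simp_all
  show "1 * a = a" by (cases a) (simp_all add: d)
  show "(a + b) * c = a * c + b * c" by (cases a; cases b; cases c) simp_all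
  show "(0::gf4) \<noteq> 1" by (simp add: d)
  show "a \<noteq> 0 \<Longrightarrow> inverse a * a = 1" by (cases a) (simp_all add: d)
  show "a div b = a * inverse b" by simp
  show "inverse (0::gf4) = 0" by (simp add: d)
qed
end

fun suc5 where "suc5 D0 = D1" | "suc5 D1 = D2" | "suc5 D2 = D3" | "suc5 D3 = D4" | "suc5 D4 = D0"
instantiation gf5 :: field begin
definition "0 = D0" definition "1 = D1"
fun plus_gf5 where "D0 + b = (b::gf5)" | "D1 + b = suc5 b" | "D2 + b = suc5 (suc5 b)" | "D3 + b = suc5 (suc5 (suc5 b))" | "D4 + b = suc5 (suc5 (suc5 (suc5 b)))"
fun uminus_gf5 where "- D0 = D0" | "- D1 = D4" | "- D2 = D3" | "- D3 = D2" | "- D4 = D1"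
fun times_gf5 where "D0 * b = (D0::gf5)" | "D1 * b = b" | "D2 * b = b + b" | "D3 * b = - (b + b)" | "D4 * b = - b"
fun minus_gf5 where "(a::gf5) - b = a + - b"
fun inverse_gf5 where "inverse D0 = D0" | "inverse D1 = D1" | "inverse D2 = D3" | "inverse D3 = D2" | "inverse D4 = D4"
fun divide_gf5 where "(a::gf5) div b = a * inverse b"
instance proof
  fix a b c :: gf5
  note d = zero_gf5_def one_gf5_def
  show "a + b + c = a + (b + c)" by (cases a; cases b; cases c) simp_all
  show "a + b = b + a" by (cases a; cases b) simp_all
  show "0 + a = a" by (cases a) (simp_all add: d)
  show "- a + a = 0" by (cases a) (simp_all add: d)
  show "a - b = a + - b" by (cases a; cases b) simp_all
  show "a * b * c = a * (b * c)" by (cases a; cases b; cases c) simp_all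
  show "a * b = b * a" by (cases a; cases b) simp_all
  show "1 * a = a" by (cases a) (simp_all add: d)
  show "(a + b) * c = a * c + b * c" by (cases a; cases b; cases c) simp_all
  show "(0::gf5) \<noteq> 1" by (simp add: d)
  show "a \<noteq> 0 \<Longrightarrow> inverse a * a = 1" by (cases a) (simp_all add: d)
  show "a div b = a * inverse b" by simp
  show "inverse (0::gf5) = 0" by (simp add: d)
qed
end


lemma UNIV_gf2: "UNIV = {A0, A1}" using gf2.exhaust by auto
lemma UNIV_gf3: "UNIV = {B0, B1, B2}" using gf3.exhaust by auto
lemma UNIV_gf4: "UNIV = {C0, C1, C2, C3}" using gf4.exhaust by auto
lemma UNIV_gf5: "UNIV = {D0, D1, D2, D3, D4}" using gf5.exhaust by auto

instance gf2 :: finite by standard (simp add: UNIV_gf2)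
instance gf3 :: finite by standard (simp add: UNIV_gf3)
instance gf4 :: finite by standard (simp add: UNIV_gf4)
instance gf5 :: finite by standard (simp add: UNIV_gf5)

lemma gf2_iso:
  assumes "field F" "order F = 2"
  shows "\<exists>h :: gf2 \<Rightarrow> _. field_iso F h"
proof -
  interpret field F by fact
  define rep where "rep a = (case a of A0 \<Rightarrow> (0::nat) | A1 \<Rightarrow> 1)" for a
  have "field_iso F (\<lambda>a. [(rep a)] \<cdot>\<^bsub>F\<^esub> \<one>\<^bsub>F\<^esub>)"
  proof (rule prime_field_iso[OF assms(2)])
    show "rep (a + b) = (rep a + rep b) mod 2" "rep (a * b) = (rep a * rep b) mod 2" for a b
      by (cases a; cases b; simp add: rep_def)+
    show "bij_betw rep UNIV {..<2}"
      by (auto simp: bij_betw_def inj_on_def UNIV_gf2 rep_def)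
  qed (simp_all add: rep_def zero_gf2_def one_gf2_def)
  then show ?thesis by blast
qed

lemma gf3_iso:
  assumes "field F" "order F = 3"
  shows "\<exists>h :: gf3 \<Rightarrow> _. field_iso F h"
proof -
  interpret field F by fact
  define rep where "rep a = (case a of B0 \<Rightarrow> (0::nat) | B1 \<Rightarrow> 1 | B2 \<Rightarrow> 2)" for a
  have "field_iso F (\<lambda>a. [(rep a)] \<cdot>\<^bsub>F\<^esub> \<one>\<^bsub>F\<^esub>)"
  proof (rule prime_field_iso[OF assms(2)])
    show "rep (a + b) = (rep a + rep b) mod 3" "rep (a * b) = (rep a * rep b) mod 3" for a b
      by (cases a; cases b; simp add: rep_def)+
    show "bij_betw rep UNIV {..<3}"
      by (auto simp: bij_betw_def inj_on_def UNIV_gf3 rep_def)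
  qed (simp_all add: rep_def zero_gf3_def one_gf3_def)
  then show ?thesis by blast
qed

lemma gf5_iso:
  assumes "field F" "order F = 5"
  shows "\<exists>h :: gf5 \<Rightarrow> _. field_iso F h"
proof -
  interpret field F by fact
  define rep where "rep a = (case a of D0 \<Rightarrow> (0::nat) | D1 \<Rightarrow> 1 | D2 \<Rightarrow> 2 | D3 \<Rightarrow> 3 | D4 \<Rightarrow> 4)" for a
  have "field_iso F (\<lambda>a. [(rep a)] \<cdot>\<^bsub>F\<^esub> \<one>\<^bsub>F\<^esub>)"
  proof (rule prime_field_iso[OF assms(2)])
    show "rep (a + b) = (rep a + rep b) mod 5" "rep (a * b) = (rep a * rep b) mod 5" for a b
      by (cases a; cases b; simp add: rep_def)+
    show "bij_betw rep UNIV {..<5}"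
      by (auto simp: bij_betw_def inj_on_def UNIV_gf5 rep_def)
    show "prime (5 :: nat)" by simp
  qed (simp_all add: rep_def zero_gf5_def one_gf5_def)
  then show ?thesis by blast
qed

text \<open>Four times \<one> is zero and equals the square of 1 + 1, so the characteristic is 2.
  Take any a other than 0 and 1, and b = 1 + a. Then a^2 can be neither 0 nor 1 nor a, so a^2 = b,
  and this fixes both operation tables.\<close>

lemma gf4_iso:
  assumes "field F" "order F = 4"
  shows "\<exists>h :: gf4 \<Rightarrow> _. field_iso F h"
proof -
  interpret field F by fact
  let ?o = "\<one>\<^bsub>F\<^esub>" and ?z = "\<zero>\<^bsub>F\<^esub>"
  have card: "card (carrier F) = 4" using assms(2) by (simp add: order_def)
  then have fin: "finite (carrier F)" by (intro card_ge_0_finite) simp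
  have "card {?z, ?o} < card (carrier F)" using card by (simp add: card_insert_if)
  then obtain a where a: "a \<in> carrier F" "a \<noteq> ?z" "a \<noteq> ?o"
    by (metis card_mono finite.emptyI finite_insert insertCI leD subsetI)
  have "[(4::nat)] \<cdot>\<^bsub>F\<^esub> ?o = ?z"
    using add.pow_order_eq_1[of ?o] card by (simp add: order_def)
  then have "(?o \<oplus>\<^bsub>F\<^esub> ?o) \<otimes>\<^bsub>F\<^esub> (?o \<oplus>\<^bsub>F\<^esub> ?o) = ?z"
    by (simp add: eval_nat_numeral l_distr r_distr a_assoc)
  then have two: "?o \<oplus>\<^bsub>F\<^esub> ?o = ?z" using integral by blast
  have dbl: "x \<oplus>\<^bsub>F\<^esub> x = ?z" if "x \<in> carrier F" for x
  proof -
    have "x \<otimes>\<^bsub>F\<^esub> (?o \<oplus>\<^bsub>F\<^esub> ?o) = x \<oplus>\<^bsub>F\<^esub> x" using that by (simp add: r_distr)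
    then show ?thesis using two that by simp
  qed
  have dbl': "x \<oplus>\<^bsub>F\<^esub> (x \<oplus>\<^bsub>F\<^esub> y) = y" if "x \<in> carrier F" "y \<in> carrier F" for x y
    using that dbl by (simp flip: a_assoc)
  define b where "b = ?o \<oplus>\<^bsub>F\<^esub> a"
  have b: "b \<in> carrier F" using a by (simp add: b_def)
  have sums: "?o \<oplus>\<^bsub>F\<^esub> a = b" "a \<oplus>\<^bsub>F\<^esub> ?o = b" "?o \<oplus>\<^bsub>F\<^esub> b = a" "b \<oplus>\<^bsub>F\<^esub> ?o = a"
    "a \<oplus>\<^bsub>F\<^esub> b = ?o" "b \<oplus>\<^bsub>F\<^esub> a = ?o"
    using a dbl dbl' two by (simp_all add: b_def a_comm a_lcomm)
  have dist: "b \<noteq> ?z" "b \<noteq> ?o" "b \<noteq> a"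
    using sums a dbl b by (metis one_closed r_zero, metis r_zero two, metis dbl one_not_zero sums(6))
  have carr: "carrier F = {?z, ?o, a, b}"
    using a b dist card by (intro card_subset_eq[symmetric] fin) auto
  have aa: "a \<otimes>\<^bsub>F\<^esub> a = b"
  proof -
    have "a \<otimes>\<^bsub>F\<^esub> a \<noteq> ?z" using a integral by blast
    moreover have "a \<otimes>\<^bsub>F\<^esub> a \<noteq> a" using a m_lcancel[of a a ?o] by auto
    moreover have "a \<otimes>\<^bsub>F\<^esub> a \<noteq> ?o"
    proof
      assume "a \<otimes>\<^bsub>F\<^esub> a = ?o"
      \<comment> \<open>In characteristic 2, a^2 = 1 makes (1 + a)^2 vanish, which contradicts b
        being nonzero.\<close>
      then have "b \<otimes>\<^bsub>F\<^esub> b = (?o \<oplus>\<^bsub>F\<^esub> a) \<oplus>\<^bsub>F\<^esub> (a \<oplus>\<^bsub>F\<^esub> ?o)"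
        using a by (simp add: b_def l_distr r_distr)
      then have "b \<otimes>\<^bsub>F\<^esub> b = ?z" using sums dbl b by simp
      then show False using dist(1) b integral by blast
    qed
    ultimately show ?thesis using carr a by (metis insertE m_closed singletonD)
  qed
  have ab: "a \<otimes>\<^bsub>F\<^esub> b = ?o"
  proof -
    have "a \<otimes>\<^bsub>F\<^esub> b = a \<oplus>\<^bsub>F\<^esub> a \<otimes>\<^bsub>F\<^esub> a" using a by (simp add: b_def r_distr)
    then show ?thesis by (simp add: aa sums)
  qed
  then have ba: "b \<otimes>\<^bsub>F\<^esub> a = ?o" using a b by (simp add: m_comm)
  have bb: "b \<otimes>\<^bsub>F\<^esub> b = a"
  proof -
    have "b \<otimes>\<^bsub>F\<^esub> b = b \<oplus>\<^bsub>F\<^esub> a \<otimes>\<^bsub>F\<^esub> b" using a b by (subst (1) b_def) (simp add: l_distr)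
    then show ?thesis by (simp add: ab sums)
  qed
  define h where "h x = (case x of C0 \<Rightarrow> ?z | C1 \<Rightarrow> ?o | C2 \<Rightarrow> a | C3 \<Rightarrow> b)" for x
  have "field_iso F h"
    unfolding field_iso_def
  proof (intro conjI allI)
    show "bij_betw h UNIV (carrier F)"
      using a dist unfolding carr by (auto simp: bij_betw_def inj_on_def UNIV_gf4 h_def)
    show "h (x + y) = h x \<oplus>\<^bsub>F\<^esub> h y" "h (x * y) = h x \<otimes>\<^bsub>F\<^esub> h y" for x y
      by (cases x; cases y; simp add: h_def a b sums dbl two aa ab ba bb)+
  qed (simp_all add: h_def zero_gf4_def one_gf4_def)
  then show ?thesis by blast
qed

section \<open>Bringing an arc into normal form\<close>

fun moves :: "(bool list \<times> 'a::field vec) list \<Rightarrow> trie \<Rightarrow> trie \<Rightarrow> 'a vec \<Rightarrow> 'a vec \<Rightarrow> 'a vec \<Rightarrow>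
    (bool list \<times> 'a vec) list \<Rightarrow> bool" where
  "moves tb m t r1 r2 r3 [] = True"
| "moves tb m t r1 r2 r3 ((p, v) # xs) =
     ((\<not> mem t p \<or> mem m (code tb (vnormalize (mat r1 r2 r3 v)))) \<and> moves tb m t r1 r2 r3 xs)"

text \<open>The matrices, given by their rows, are matched with the arcs by position. A list of
  matrices that is too short fails the test, so no generated arc is overlooked.\<close>

fun all_move :: "(bool list \<times> 'a::field vec) list \<Rightarrow> trie \<Rightarrow> trie list \<Rightarrow> ('a vec \<times> 'a vec \<times> 'a vec) list \<Rightarrow> bool" where
  "all_move tb m [] Rs = True"
| "all_move tb m (t # ts) [] = False"
| "all_move tb m (t # ts) ((r1, r2, r3) # Rs) =
     (det3 r1 r2 r3 \<noteq> 0 \<and> moves tb m t r1 r2 r3 tb \<and> all_move tb m ts Rs)"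

lemma moves_iff:
  "moves tb m t r1 r2 r3 xs \<longleftrightarrow>
     (\<forall>(p, v)\<in>set xs. p \<in> pts t \<longrightarrow> code tb (vnormalize (mat r1 r2 r3 v)) \<in> pts m)"
  by (induction tb m t r1 r2 r3 xs rule: moves.induct) (auto simp: mem_iff simp del: mat.simps)

lemma all_moveD:
  "all_move tb m ts Rs \<Longrightarrow> t \<in> set ts \<Longrightarrow> \<exists>r1 r2 r3. det3 r1 r2 r3 \<noteq> 0 \<and> moves tb m t r1 r2 r3 tb"
  by (induction tb m ts Rs rule: all_move.induct) auto

text \<open>The adjugate matrix has the cross products of the rows as columns; applied to the
  product with \<open>v\<close> it returns \<open>v\<close> times the determinant.\<close>

lemma mat_kernel:
  assumes "det3 r1 r2 r3 \<noteq> 0" "mat r1 r2 r3 v = zero_vec"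
  shows "v = zero_vec"
proof -
  have "scale (det3 r1 r2 r3) v = vadd (scale (dot r1 v) (cross r2 r3))
      (vadd (scale (dot r2 v) (cross r3 r1)) (scale (dot r3 v) (cross r1 r2)))"
    by (cases r1; cases r2; cases r3; cases v) (simp add: det3_def algebra_simps)
  then have "scale (det3 r1 r2 r3) v = zero_vec"
    using assms(2) by (cases r1; cases r2; cases r3) simp
  then show ?thesis using assms(1) scale_eq_zero_iff by blast
qed

lemma is_arc_image:
  assumes lab: "labelling els d tb" and c: "coordinates P L c"
    and l: "l \<subseteq> P" "finite l" "\<And>k. k \<in> L \<Longrightarrow> card (k \<inter> l) \<le> 2"
  shows "is_arc (lines_of tb) ((\<lambda>p. code tb (vnormalize (c p))) ` l)"
proof -
  define f where "f p = code tb (vnormalize (c p))" for p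
  have bij: "bij_betw f P (set (points_of tb))" and L: "(`) f ` L = pts ` set (lines_of tb)"
    using coordinates_code[OF lab c] by (simp_all add: f_def[abs_def])
  have inj: "inj_on f P" using bij by (auto simp: bij_betw_def)
  have "card (f ` l \<inter> pts t) \<le> 2" if "t \<in> set (lines_of tb)" for t
  proof -
    have "pts t \<in> (`) f ` L" using that L by simp
    then obtain k where k: "k \<in> L" "pts t = f ` k" by auto
    have "k \<subseteq> P" using c k(1) by (auto simp: coordinates_def)
    then have "f ` l \<inter> f ` k = f ` (l \<inter> k)" using inj l(1) by (simp add: inj_on_image_Int)
    then have "card (f ` l \<inter> pts t) \<le> card (l \<inter> k)" using k(2) l(2) by (simp add: card_image_le)
    then show ?thesis using l(3)[OF k(1)] by (simp add: Int_commute)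
  qed
  then show ?thesis using l(2) by (simp add: is_arc_def f_def[abs_def])
qed

text \<open>The encoded image of \<open>l\<close> contains \<open>s\<close>, so it is among the
  generated arcs, and the matrix belonging to it is applied to the coordinates. The test only gives
  inclusion in \<open>m\<close>; equality follows from equal size.\<close>

lemma arc_normal_form:
  fixes c :: "'b \<Rightarrow> 'a::{field, finite} vec"
  assumes lab: "labelling els d tb" and c: "coordinates P L c"
    and l: "l \<subseteq> P" "card l = k + card (set s)" "card l = card (pts m)" "finite l" "\<And>k. k \<in> L \<Longrightarrow> card (k \<inter> l) \<le> 2"
    and s: "set s \<subseteq> (\<lambda>p. code tb (vnormalize (c p))) ` l"
    and all: "all_move tb m (arcs (lines_of tb) k s (points_of tb)) Rs"
  obtains c' :: "'b \<Rightarrow> 'a vec" where "coordinates P L c'" "(\<lambda>p. code tb (vnormalize (c' p))) ` l = pts m"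
proof -
  define f where "f p = code tb (vnormalize (c p))" for p
  have bij: "bij_betw f P (set (points_of tb))"
    using coordinates_code[OF lab c] by (simp add: f_def[abs_def])
  then have inj: "inj_on f P" and fP: "f ` P = set (points_of tb)" by (auto simp: bij_betw_def)
  have fl: "f ` l \<subseteq> set (points_of tb)" using l(1) fP by auto
  have "f ` l \<in> pts ` set (arcs (lines_of tb) k s (points_of tb))"
  proof (rule arcs_complete)
    show "is_arc (lines_of tb) (f ` l)"
      using is_arc_image[OF lab c l(1,4,5)] by (simp add: f_def[abs_def])
    show "set s \<subseteq> f ` l" using s by (simp add: f_def[abs_def])
    show "f ` l \<subseteq> set s \<union> set (points_of tb)" using fl by auto
    show "card (f ` l) = k + card (set s)" using l(2) card_image[OF inj_on_subset[OF inj l(1)]] by simp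
    show "\<And>p. p \<in> f ` l \<Longrightarrow> length p = d" using labellingD(4)[OF lab] fl by blast
  qed
  then obtain t where t: "t \<in> set (arcs (lines_of tb) k s (points_of tb))" "f ` l = pts t" by auto
  obtain r1 r2 r3 where r: "det3 r1 r2 r3 \<noteq> 0" "moves tb m t r1 r2 r3 tb"
    using all_moveD[OF all t(1)] by blast
  let ?c = "\<lambda>p. mat r1 r2 r3 (c p)"
  have c': "coordinates P L ?c"
    by (rule coordinates_mat[OF c mat_kernel[OF r(1)]])
  define f' where "f' p = code tb (vnormalize (?c p))" for p
  have inj': "inj_on f' P"
    using coordinates_code(1)[OF lab c'] by (auto simp: bij_betw_def f'_def[abs_def] simp del: mat.simps)
  have "f' ` l \<subseteq> pts m"
  proof
    fix x assume "x \<in> f' ` l"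
    then obtain p where p: "p \<in> l" "x = f' p" by auto
    then have nz: "c p \<noteq> zero_vec" using c l(1) by (auto simp: coordinates_def)
    obtain j where j: "j \<noteq> 0" "vnormalize (c p) = scale j (c p)" using normalize_eq_scale[OF nz] .
    have "vnormalize (c p) \<in> normalized" using nz by (auto simp: normalized_def)
    then have "(f p, vnormalize (c p)) \<in> set tb" using code_in[OF lab] by (simp add: f_def)
    moreover have "f p \<in> pts t" using p(1) t(2) by auto
    ultimately have "code tb (vnormalize (mat r1 r2 r3 (vnormalize (c p)))) \<in> pts m"
      using r(2) unfolding moves_iff by blast
    \<comment> \<open>The table was tested on normalised vectors only; \<open>c p\<close> differs
      from one by a nonzero scalar, which the matrix passes through.\<close>
    moreover have "vnormalize (mat r1 r2 r3 (vnormalize (c p))) = vnormalize (?c p)"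
      unfolding j(2) mat_scale by (rule normalize_scale[OF j(1)])
    ultimately show "x \<in> pts m" using p(2) by (simp add: f'_def del: mat.simps)
  qed
  moreover have "card (f' ` l) = card (pts m)"
    using card_image[OF inj_on_subset[OF inj' l(1)]] l(3) by simp
  ultimately have "f' ` l = pts m" by (simp add: card_subset_eq)
  then show ?thesis using that[OF c'] by (simp add: f'_def[abs_def] del: mat.simps)
qed

lemma set_codes: "set (codes tb vs) = code tb ` set vs"
  by (induction vs) auto

lemma obtain_distinct_4:
  assumes "4 \<le> card l"
  obtains p1 p2 p3 p4 where "{p1, p2, p3, p4} \<subseteq> l" "distinct [p1, p2, p3, p4]"
proof -
  obtain s where s: "s \<subseteq> l" "card s = 4" "finite s"
    using assms by (metis card_ge_0_finite finite_subset obtain_subset_with_card_n zero_less_numeral)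
  obtain xs where xs: "set xs = s" "distinct xs" using finite_distinct_list[OF s(3)] by auto
  then have "length xs = 4" using s(2) distinct_card by metis
  then obtain p1 p2 p3 p4 where "xs = [p1, p2, p3, p4]"
    by (auto simp: length_Suc_conv eval_nat_numeral)
  then show ?thesis using that[of p1 p2 p3 p4] xs s(1) by auto
qed

lemma three_points_le_2:
  assumes "distinct [x, y, z]" "{x, y, z} \<subseteq> k \<inter> l" "finite l" "card (k \<inter> l) \<le> 2"
  shows False
proof -
  have "card {x, y, z} \<le> card (k \<inter> l)" using assms by (intro card_mono) auto
  then show False using assms(1,4) by simp
qed

definition frame :: "'a::field vec list" where
  "frame = [Vec 1 0 0, Vec 0 1 0, Vec 0 0 1, Vec 1 1 1]"

text \<open>No three points of an arc are collinear, so any four of them can be made the standard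
  frame; enumeration accounts for the other \<open>k\<close> points.\<close>

lemma four_arc_normal_form:
  fixes c :: "'b \<Rightarrow> 'a::{field, finite} vec"
  assumes lab: "labelling els d tb" and c: "coordinates P L c"
    and l: "l \<subseteq> P" "card l = k + 4" "card (pts m) = k + 4" "\<And>k. k \<in> L \<Longrightarrow> card (k \<inter> l) \<le> 2"
    and all: "all_move tb m (arcs (lines_of tb) k (codes tb frame) (points_of tb)) Rs"
  obtains c' :: "'b \<Rightarrow> 'a vec" where "coordinates P L c'" "(\<lambda>p. code tb (vnormalize (c' p))) ` l = pts m"
proof -
  have fin: "finite l" using l(2) by (intro card_ge_0_finite) simp
  obtain p1 p2 p3 p4 where p: "{p1, p2, p3, p4} \<subseteq> l" "distinct [p1, p2, p3, p4]"
    by (rule obtain_distinct_4[of l]) (use l(2) in auto)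
  have nc: False if "k \<in> L" "{x, y, z} \<subseteq> {p1, p2, p3, p4}" "distinct [x, y, z]" "{x, y, z} \<subseteq> k" for k x y z
    using three_points_le_2[OF that(3) _ fin l(4)[OF that(1)]] that p(1) by blast
  obtain c1 :: "'b \<Rightarrow> 'a vec" where c1: "coordinates P L c1"
    "vnormalize (c1 p1) = Vec 1 0 0" "vnormalize (c1 p2) = Vec 0 1 0" "vnormalize (c1 p3) = Vec 0 0 1"
    "vnormalize (c1 p4) = Vec 1 1 1"
    by (rule four_point_frame[OF c _ _ _ _ p(2) nc]) (use p(1) l(1) in auto)
  let ?f = "\<lambda>p. code tb (vnormalize (c1 p))"
  have eq: "set (codes tb frame) = ?f ` {p1, p2, p3, p4}"
    using c1 by (simp add: frame_def)
  have "inj_on ?f P" using coordinates_code(1)[OF lab c1(1)] by (auto simp: bij_betw_def)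
  then have "inj_on ?f {p1, p2, p3, p4}" by (rule inj_on_subset) (use p l in auto)
  then have "card (set (codes tb frame)) = 4"
    unfolding eq using p(2) by (subst card_image) auto
  then show ?thesis
    by (intro arc_normal_form[OF lab c1(1) l(1) _ _ fin l(4) _ all that]) (use l p(1) eq in auto)
qed

text \<open>Serves q = 2, where an arc of q + 1 points is just a triangle and can be moved to the
  coordinate triangle.\<close>

lemma three_arc_normal_form:
  fixes c :: "'b \<Rightarrow> 'a::{field, finite} vec"
  assumes lab: "labelling els d tb" and c: "coordinates P L c"
    and l: "l \<subseteq> P" "card l = 3" "card (pts m) = 3" "\<And>k. k \<in> L \<Longrightarrow> card (k \<inter> l) \<le> 2"
    and all: "all_move tb m (arcs (lines_of tb) 0 (codes tb (take 3 frame)) (points_of tb)) Rs"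
  obtains c' :: "'b \<Rightarrow> 'a vec" where "coordinates P L c'" "(\<lambda>p. code tb (vnormalize (c' p))) ` l = pts m"
proof -
  have fin: "finite l" using l(2) by (intro card_ge_0_finite) simp
  obtain p1 p2 p3 where p: "l = {p1, p2, p3}" "distinct [p1, p2, p3]"
    using l(2) by (auto simp: card_3_iff)
  have nc: False if "k \<in> L" "p1 \<in> k" "p2 \<in> k" "p3 \<in> k" for k
    using three_points_le_2[OF p(2) _ fin l(4)[OF that(1)]] that p(1) by blast
  obtain c1 :: "'b \<Rightarrow> 'a vec" where c1: "coordinates P L c1"
    "vnormalize (c1 p1) = Vec 1 0 0" "vnormalize (c1 p2) = Vec 0 1 0" "vnormalize (c1 p3) = Vec 0 0 1"
    by (rule three_point_frame[OF c, of p1 p2 p3]) (use p l(1) nc in auto)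
  let ?f = "\<lambda>p. code tb (vnormalize (c1 p))"
  have eq: "set (codes tb (take 3 frame)) = ?f ` l"
    using c1 p(1) by (simp add: frame_def)
  have "inj_on ?f P" using coordinates_code(1)[OF lab c1(1)] by (auto simp: bij_betw_def)
  then have "card (set (codes tb (take 3 frame))) = 3"
    unfolding eq using l by (subst card_image) (auto intro: inj_on_subset)
  then show ?thesis
    by (intro arc_normal_form[OF lab c1(1) l(1) _ _ fin l(4) _ all that]) (use l eq in auto)
qed

section \<open>Upper bounds from an empty search\<close>

text \<open>A set that is infinite or too large contains n + 1 planes: the reference plane
  \<open>L\<close> and the \<open>n\<close> planes of \<open>Ls\<close>. Coordinates of
  \<open>L\<close> are chosen such that a line of the first plane in \<open>Ls\<close> becomes
  \<open>m\<close>; then \<open>search_nonempty\<close> contradicts the computed result.\<close>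

lemma card_le_of_search:
  fixes els :: "'a::{field, finite} list" and P :: "'b set"
  assumes lab: "labelling els d tb"
    and iso: "\<And>F :: nat ring. field F \<Longrightarrow> order F = q \<Longrightarrow> \<exists>h :: 'a \<Rightarrow> nat. field_iso F h"
    and nf: "\<And>(c :: 'b \<Rightarrow> 'a vec) L l. coordinates P L c \<Longrightarrow> l \<subseteq> P \<Longrightarrow> card l = q + 1 \<Longrightarrow>
       (\<And>k. k \<in> L \<Longrightarrow> card (k \<inter> l) \<le> 2) \<Longrightarrow>
       \<exists>c' :: 'b \<Rightarrow> 'a vec. coordinates P L c' \<and> (\<lambda>p. code tb (vnormalize (c' p))) ` l = pts m"
    and steps: "\<And>s. s \<in> set ps \<Longrightarrow> good_step (lines_of tb) (set (points_of tb)) q m s"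
      "\<And>i x ys T. (i, x, ys, T) \<in> set ps \<Longrightarrow> i < n"
    and search: "search ps ([m] # replicate (n - 1) []) = []" and "0 < n"
    and S: "mutually_orthogoval_PG2 q P S"
  shows "finite S \<and> card S \<le> n"
proof (rule ccontr)
  assume "\<not> (finite S \<and> card S \<le> n)"
  then obtain T where T: "T \<subseteq> S" "card T = Suc n" "finite T"
    by (metis infinite_arbitrarily_large not_less_eq_eq obtain_subset_with_card_n finite_subset)
  obtain Ts where Ts: "set Ts = T" "distinct Ts" using finite_distinct_list[OF T(3)] by auto
  then have "length Ts = Suc n" using T(2) distinct_card by metis
  then obtain L Ls where LLs: "Ts = L # Ls" "length Ls = n" by (auto simp: length_Suc_conv)
  have L: "L \<in> S" and Ls: "\<And>i. i < n \<Longrightarrow> Ls ! i \<in> S" using LLs Ts(1) T(1) nth_mem by auto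
  have plane: "\<And>M. M \<in> S \<Longrightarrow> projective_plane P M q"
    and pg: "\<And>M. M \<in> S \<Longrightarrow> isomorphic_to_PG2 q P M"
    and orth: "\<And>M N. M \<in> S \<Longrightarrow> N \<in> S \<Longrightarrow> M \<noteq> N \<Longrightarrow> orthogoval M N"
    using S by (auto simp: mutually_orthogoval_PG2_def pairwise_def)
  have L_Ls: "orthogoval L (Ls ! i)" if "i < n" for i
    using orth[OF L Ls[OF that]] Ts(2) LLs that nth_mem by auto
  have Ls_Ls: "orthogoval (Ls ! i) (Ls ! j)" if "i < n" "j < n" "i \<noteq> j" for i j
    using orth[OF Ls[OF that(1)] Ls[OF that(2)]] Ts(2) LLs that by (auto simp: nth_eq_iff_index_eq)
  obtain F :: "nat ring" where F: "field F" "order F = q" "planes_isomorphic P L (PG2_points F) (PG2_lines F)"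
    using pg[OF L] by (auto simp: isomorphic_to_PG2_def)
  obtain h :: "'a \<Rightarrow> nat" where h: "field_iso F h" using iso[OF F(1,2)] by blast
  have LP: "\<And>l. l \<in> L \<Longrightarrow> l \<subseteq> P" using projective_plane.lines_subset[OF plane[OF L]] .
  obtain c :: "'b \<Rightarrow> 'a vec" where c: "coordinates P L c"
    using planes_isomorphic_iff_coordinates[OF h LP] F(3) by blast
  interpret M: projective_plane P "Ls ! 0" q using plane[OF Ls] \<open>0 < n\<close> by blast
  \<comment> \<open>The quadrangle is used to obtain two distinct points, and thereby some
    line.\<close>
  obtain Q where Q: "Q \<subseteq> P" "card Q = 4" using M.quadrangle by blast
  then obtain x y where xy: "x \<in> P" "y \<in> P" "x \<noteq> y"
    by (metis obtain_distinct_4 distinct_length_2_or_more insert_subset order_refl subsetD)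
  then obtain l where l: "l \<in> Ls ! 0" using M.unique_line by blast
  have "card (k \<inter> l) \<le> 2" if "k \<in> L" for k
    using L_Ls[of 0] \<open>0 < n\<close> that l by (auto simp: orthogoval_def)
  then obtain c' :: "'b \<Rightarrow> 'a vec" where c': "coordinates P L c'" "(\<lambda>p. code tb (vnormalize (c' p))) ` l = pts m"
    using nf[OF c M.lines_subset[OF l] M.card_line[OF l]] by blast
  have "search ps ([m] # replicate (length Ls - 1) []) \<noteq> []"
    by (rule search_nonempty[OF lab c'(1) _ _ _ _ l c'(2)])
      (use plane Ls L_Ls Ls_Ls steps LLs(2) \<open>0 < n\<close> in auto)
  then show False using search LLs(2) by simp
qed

section \<open>Lower bounds from explicit planes\<close>

fun meet_once :: "trie list \<Rightarrow> bool" where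
  "meet_once [] = True"
| "meet_once (t # ts) = (list_all (\<lambda>u. cnt t u 0 = 1) ts \<and> meet_once ts)"

fun all_joined :: "trie list \<Rightarrow> bool list list \<Rightarrow> bool" where
  "all_joined B [] = True"
| "all_joined B (p # ps) = (list_all (on_some (incident B p)) ps \<and> all_joined B ps)"

definition plane_ok :: "nat \<Rightarrow> bool list list \<Rightarrow> trie list \<Rightarrow> bool list list \<Rightarrow> bool" where
  "plane_ok q V B Q \<longleftrightarrow> list_all (\<lambda>t. cnt t t 0 = Suc q) B \<and> meet_once B \<and> all_joined B V \<and>
     list_all (\<lambda>p. p \<in> set V) Q \<and> distinct Q \<and> length Q = 4 \<and> ok2 (mktrie Q) B"

lemma meet_onceD:
  "meet_once ts \<Longrightarrow> t \<in> set ts \<Longrightarrow> u \<in> set ts \<Longrightarrow> pts t \<noteq> pts u \<Longrightarrow> card (pts t \<inter> pts u) = 1"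
  by (induction ts) (auto simp: list_all_iff cnt_eq Int_commute)

lemma all_joinedD:
  "all_joined B ps \<Longrightarrow> p \<in> set ps \<Longrightarrow> r \<in> set ps \<Longrightarrow> p \<noteq> r \<Longrightarrow> \<exists>t\<in>set B. p \<in> pts t \<and> r \<in> pts t"
  by (induction ps) (auto simp: list_all_iff on_some_iff set_incident)

lemma card_1_imp_ex1: "card A = 1 \<Longrightarrow> \<exists>!x. x \<in> A"
  by (auto simp: card_1_singleton_iff)

text \<open>Existence of joining lines is tested directly; their uniqueness follows because
  different lines share exactly one point.\<close>

lemma plane_ok_correct:
  assumes ok: "plane_ok q (points_of tb) (lines_of tb) Q" and "2 \<le> q" and lab: "labelling els d tb"
  shows "projective_plane (set (points_of tb)) (pts ` set (lines_of tb)) q"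
proof
  let ?V = "set (points_of tb)" and ?L = "pts ` set (lines_of tb)"
  have ok': "\<And>t. t \<in> set (lines_of tb) \<Longrightarrow> card (pts t) = q + 1" "meet_once (lines_of tb)"
    "all_joined (lines_of tb) (points_of tb)" "set Q \<subseteq> ?V" "distinct Q" "length Q = 4" "ok2 (mktrie Q) (lines_of tb)"
    using ok by (auto simp: plane_ok_def list_all_iff cnt_eq)
  have meet: "card (l \<inter> m) = 1" if "l \<in> ?L" "m \<in> ?L" "l \<noteq> m" for l m
    using that meet_onceD[OF ok'(2)] by auto
  show sub: "l \<subseteq> ?V" if "l \<in> ?L" for l
    using that coordinates_table[OF lab] by (auto simp: coordinates_def)
  show "2 \<le> q" by fact
  show "card l = q + 1" if "l \<in> ?L" for l using that ok'(1) by auto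
  show "\<exists>!l. l \<in> ?L \<and> x \<in> l \<and> y \<in> l" if xy: "x \<in> ?V" "y \<in> ?V" "x \<noteq> y" for x y
  proof -
    obtain l where l: "l \<in> ?L" "x \<in> l" "y \<in> l" using all_joinedD[OF ok'(3) xy] by auto
    moreover have "m = l" if m: "m \<in> ?L" "x \<in> m" "y \<in> m" for m
    proof (rule ccontr)
      assume "m \<noteq> l"
      then have "card (m \<inter> l) = 1" using meet m(1) l(1) by blast
      then have "\<exists>!z. z \<in> m \<inter> l" by (rule card_1_imp_ex1)
      then show False using l m xy(3) by blast
    qed
    ultimately show ?thesis by blast
  qed
  show "\<exists>!x. x \<in> ?V \<and> x \<in> l \<and> x \<in> m" if "l \<in> ?L" "m \<in> ?L" "l \<noteq> m" for l m
  proof -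
    have "\<exists>!x. x \<in> l \<inter> m" by (rule card_1_imp_ex1[OF meet[OF that]])
    then show ?thesis using sub[OF that(1)] by blast
  qed
  have "pts (mktrie Q) = set Q"
    using mktrie_correct[of Q d] labellingD(4)[OF lab] ok'(4) by blast
  then show "\<exists>A\<subseteq>?V. card A = 4 \<and> (\<forall>l\<in>?L. finite (A \<inter> l) \<and> card (A \<inter> l) \<le> 2)"
    using ok'(4,5,6,7) by (intro exI[of _ "set Q"]) (auto simp: ok2_iff distinct_card)
qed

lemma projective_plane_image:
  assumes "projective_plane P L q" and f: "bij_betw f P P'"
  shows "projective_plane P' ((`) f ` L) q"
proof -
  interpret projective_plane P L q by fact
  have inj: "inj_on f P" and fP: "f ` P = P'" using f by (auto simp: bij_betw_def)
  have mem: "f x \<in> f ` l \<longleftrightarrow> x \<in> l" if "x \<in> P" "l \<in> L" for x l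
    using inj_on_image_mem_iff[OF inj that(1) lines_subset[OF that(2)]] .
  show ?thesis
  proof
    show "2 \<le> q" by (rule order_ge_2)
    show "l \<subseteq> P'" if "l \<in> (`) f ` L" for l using that lines_subset fP by auto
    show "card l = q + 1" if "l \<in> (`) f ` L" for l
      using that card_line card_image[OF inj_on_subset[OF inj lines_subset]] by auto
    show "\<exists>!l. l \<in> (`) f ` L \<and> x' \<in> l \<and> y' \<in> l" if xy': "x' \<in> P'" "y' \<in> P'" "x' \<noteq> y'" for x' y'
    proof -
      obtain x y where xy: "x \<in> P" "y \<in> P" "x' = f x" "y' = f y" "x \<noteq> y" using xy' fP by blast
      obtain l where l: "l \<in> L" "x \<in> l" "y \<in> l" "\<And>m. m \<in> L \<Longrightarrow> x \<in> m \<Longrightarrow> y \<in> m \<Longrightarrow> m = l"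
        using unique_line[OF xy(1,2,5)] by blast
      show ?thesis
      proof (rule ex1I[of _ "f ` l"])
        fix m' assume "m' \<in> (`) f ` L \<and> x' \<in> m' \<and> y' \<in> m'"
        then obtain m where "m \<in> L" "m' = f ` m" "f x \<in> f ` m" "f y \<in> f ` m" using xy by auto
        then show "m' = f ` l" using l(4) mem xy(1,2) by auto
      qed (use l(1-3) xy in auto)
    qed
    show "\<exists>!x'. x' \<in> P' \<and> x' \<in> l' \<and> x' \<in> m'" if lm': "l' \<in> (`) f ` L" "m' \<in> (`) f ` L" "l' \<noteq> m'" for l' m'
    proof -
      obtain l m where lm: "l \<in> L" "m \<in> L" "l' = f ` l" "m' = f ` m" "l \<noteq> m" using lm' by blast
      obtain x where x: "x \<in> P" "x \<in> l" "x \<in> m" "\<And>y. y \<in> P \<Longrightarrow> y \<in> l \<Longrightarrow> y \<in> m \<Longrightarrow> y = x"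
        using unique_point[OF lm(1,2,5)] by blast
      show ?thesis
      proof (rule ex1I[of _ "f x"])
        show "f x \<in> P' \<and> f x \<in> l' \<and> f x \<in> m'" using x(1-3) fP lm(3,4) by blast
      next
        fix y' assume y': "y' \<in> P' \<and> y' \<in> l' \<and> y' \<in> m'"
        then obtain y where "y \<in> P" "y' = f y" using fP by blast
        then show "y' = f x" using x(4) y' lm mem by auto
      qed
    qed
    obtain Q where Q: "Q \<subseteq> P" "card Q = 4" "\<And>l. l \<in> L \<Longrightarrow> finite (Q \<inter> l) \<and> card (Q \<inter> l) \<le> 2"
      using quadrangle by blast
    show "\<exists>A\<subseteq>P'. card A = 4 \<and> (\<forall>l\<in>(`) f ` L. finite (A \<inter> l) \<and> card (A \<inter> l) \<le> 2)"
    proof (intro exI[of _ "f ` Q"] conjI ballI)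
      show "f ` Q \<subseteq> P'" using Q(1) fP by auto
      show "card (f ` Q) = 4" using card_image[OF inj_on_subset[OF inj Q(1)]] Q(2) by simp
      fix l' assume "l' \<in> (`) f ` L"
      then obtain l where l: "l \<in> L" "l' = f ` l" by auto
      have eq: "f ` Q \<inter> l' = f ` (Q \<inter> l)"
        using inj_on_image_Int[OF inj Q(1) lines_subset[OF l(1)]] l(2) by simp
      show "finite (f ` Q \<inter> l')" using Q(3)[OF l(1)] eq by simp
      show "card (f ` Q \<inter> l') \<le> 2"
        using Q(3)[OF l(1)] card_image_le[of "Q \<inter> l" f] eq by simp
    qed
  qed
qed

lemma coordinates_image:
  fixes c :: "'b \<Rightarrow> 'a::field vec"
  assumes c: "coordinates P L c" and f: "bij_betw f P P'"
  shows "coordinates P' ((`) f ` L) (\<lambda>x. c (the_inv_into P f x))"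
proof -
  let ?c = "\<lambda>x. c (the_inv_into P f x)"
  have inj: "inj_on f P" and fP: "f ` P = P'" using f by (auto simp: bij_betw_def)
  have inv: "the_inv_into P f (f p) = p" if "p \<in> P" for p using the_inv_into_f_f[OF inj that] .
  have "f ` {p \<in> P. dot w (c p) = 0} = {p \<in> P'. dot w (?c p) = 0}" for w
    using inv fP by auto
  then have "(`) f ` L = (\<lambda>w. {p \<in> P'. dot w (?c p) = 0}) ` {w. w \<noteq> zero_vec}"
    using c by (simp add: coordinates_def image_image)
  moreover have "bij_betw (\<lambda>x. vnormalize (?c x)) P' normalized"
    using bij_betw_trans[OF bij_betw_the_inv_into[OF f], of "\<lambda>p. vnormalize (c p)"] c
    by (auto simp: coordinates_def comp_def)
  moreover have "\<forall>x\<in>P'. ?c x \<noteq> zero_vec"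
    using c inv fP by (auto simp: coordinates_def)
  ultimately show ?thesis
    unfolding coordinates_def by blast
qed

fun orth_all :: "trie list \<Rightarrow> trie list \<Rightarrow> bool" where
  "orth_all [] K = True"
| "orth_all (t # ts) K = (ok2 t K \<and> orth_all ts K)"

fun orth_tables :: "(bool list \<times> 'a::field vec) list list \<Rightarrow> bool" where
  "orth_tables [] = True"
| "orth_tables (tb # tbs) = (list_all (\<lambda>tb'. orth_all (lines_of tb) (lines_of tb')) tbs \<and> orth_tables tbs)"

lemma orth_all_iff: "orth_all ts K \<longleftrightarrow> orthogoval (pts ` set ts) (pts ` set K)"
  by (induction ts) (auto simp: ok2_iff orthogoval_def)

lemma orthogoval_sym: "orthogoval L M \<longleftrightarrow> orthogoval M L"
  unfolding orthogoval_def by (metis Int_commute)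

lemma orthogoval_image:
  assumes "orthogoval L M" "inj_on f P" "\<And>l. l \<in> L \<union> M \<Longrightarrow> l \<subseteq> P"
  shows "orthogoval ((`) f ` L) ((`) f ` M)"
  unfolding orthogoval_def
proof (intro ballI)
  fix l' m' assume "l' \<in> (`) f ` L" "m' \<in> (`) f ` M"
  then obtain l m where lm: "l \<in> L" "m \<in> M" "l' = f ` l" "m' = f ` m" by auto
  have eq: "l' \<inter> m' = f ` (l \<inter> m)"
    unfolding lm using inj_on_image_Int[OF assms(2)] assms(3) lm by auto
  have "finite (l \<inter> m)" "card (l \<inter> m) \<le> 2" using assms(1) lm by (auto simp: orthogoval_def)
  then show "finite (l' \<inter> m') \<and> card (l' \<inter> m') \<le> 2"
    unfolding eq using card_image_le[of "l \<inter> m" f] by auto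
qed

lemma orth_tablesD:
  "orth_tables tbs \<Longrightarrow> i < length tbs \<Longrightarrow> j < length tbs \<Longrightarrow> i \<noteq> j \<Longrightarrow>
     orthogoval (pts ` set (lines_of (tbs ! i))) (pts ` set (lines_of (tbs ! j)))"
proof (induction tbs arbitrary: i j)
  case (Cons tb tbs)
  show ?case
  proof (cases i; cases j)
    fix j' assume "i = 0" "j = Suc j'"
    then show ?thesis using Cons.prems by (auto simp: list_all_iff orth_all_iff)
  next
    fix i' assume "i = Suc i'" "j = 0"
    then show ?thesis using Cons.prems by (subst orthogoval_sym) (auto simp: list_all_iff orth_all_iff)
  next
    fix i' j' assume "i = Suc i'" "j = Suc j'"
    then show ?thesis using Cons by auto
  qed (use Cons.prems in auto)
qed simp

text \<open>Any bijection from the code words to \<open>P\<close> carries the tested planes over,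
  preserving the axioms, the coordinates and the intersection sizes.\<close>

lemma orthogoval_planes_exist:
  fixes els :: "'a::{field, finite} list" and P :: "'b set"
  assumes tbs: "\<And>tb. tb \<in> set tbs \<Longrightarrow> labelling els d tb \<and> set (points_of tb) = V \<and>
      plane_ok q (points_of tb) (lines_of tb) (codes tb frame)" "orth_tables tbs"
    and q: "2 \<le> q" "card (UNIV :: 'a set) = q" and P: "finite P" "card P = card V" and V: "finite V"
  shows "\<exists>S. mutually_orthogoval_PG2 q P S \<and> finite S \<and> card S = length tbs"
proof -
  obtain f where f: "bij_betw f V P" using finite_same_card_bij[OF V P(1)] P(2) by auto
  define M where "M i = (`) f ` pts ` set (lines_of (tbs ! i))" for i
  obtain F :: "nat ring" and h :: "'a \<Rightarrow> nat" where F: "field F" "order F = q" "field_iso F h"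
    using nat_field_copy q(2) by metis
  have plane: "projective_plane V (pts ` set (lines_of (tbs ! i))) q" if "i < length tbs" for i
    using plane_ok_correct[OF _ q(1)] tbs(1)[OF nth_mem[OF that]] by auto
  have M_plane: "projective_plane P (M i) q" if "i < length tbs" for i
    unfolding M_def by (rule projective_plane_image[OF plane[OF that] f])
  have M_iso: "isomorphic_to_PG2 q P (M i)" if "i < length tbs" for i
  proof -
    have "coordinates V (pts ` set (lines_of (tbs ! i))) (the_inv_into normalized (code (tbs ! i)))"
      using coordinates_table tbs(1)[OF nth_mem[OF that]] by metis
    then have "\<exists>c :: 'b \<Rightarrow> 'a vec. coordinates P (M i) c"
      unfolding M_def using coordinates_image f by blast
    then have "planes_isomorphic P (M i) (PG2_points F) (PG2_lines F)"
      using planes_isomorphic_iff_coordinates[OF F(3)] projective_plane.lines_subset[OF M_plane[OF that]]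
      by blast
    then show ?thesis using F(1,2) by (auto simp: isomorphic_to_PG2_def)
  qed
  have orth: "orthogoval (M i) (M j)" if "i < length tbs" "j < length tbs" "i \<noteq> j" for i j
    unfolding M_def
    using orthogoval_image[OF orth_tablesD[OF tbs(2) that] bij_betw_imp_inj_on[OF f]]
      projective_plane.lines_subset[OF plane] that by blast
  \<comment> \<open>A plane is never orthogoval to itself, as its lines have q + 1 > 2 points. So
    the planes are distinct and \<open>length tbs\<close> counts them.\<close>
  have "M i \<noteq> M j" if "i < length tbs" "j < length tbs" "i \<noteq> j" for i j
  proof
    assume eq: "M i = M j"
    interpret projective_plane P "M i" q by (rule M_plane[OF that(1)])
    obtain A where "A \<subseteq> P" "card A = 4" using quadrangle by blast
    then obtain x y where "x \<in> P" "y \<in> P" "x \<noteq> y"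
      by (metis obtain_distinct_4 distinct_length_2_or_more insert_subset order_refl subsetD)
    then obtain l where l: "l \<in> M i" using unique_line by blast
    then have "card (l \<inter> l) \<le> 2" using orth[OF that] eq unfolding orthogoval_def by metis
    then show False using card_line[OF l] q(1) by simp
  qed
  then have "inj_on M {..<length tbs}" by (auto simp: inj_on_def)
  then have "card (M ` {..<length tbs}) = length tbs" by (simp add: card_image)
  moreover have "mutually_orthogoval_PG2 q P (M ` {..<length tbs})"
    using M_plane M_iso orth by (auto simp: mutually_orthogoval_PG2_def pairwise_def)
  ultimately show ?thesis by blast
qed

text \<open>The vector at position j receives the code word at position \<open>\<pi> ! j\<close>,
  which gives the image of the plane under a permutation of its points.\<close>

definition relabel :: "nat list \<Rightarrow> (bool list \<times> 'a vec) list \<Rightarrow> (bool list \<times> 'a vec) list" where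
  "relabel \<pi> tb = zip (map ((!) (points_of tb)) \<pi>) (map snd tb)"

lemma card_pts: "card (pts t) = cnt t t 0"
  by (simp add: cnt_eq)

section \<open>Assembly of the two bounds\<close>

text \<open>Two planes beside the reference plane, the first having \<open>m\<close> as a line.
  Steps are made at the first \<open>n\<close> points of \<open>m\<close>.\<close>

definition mixed_search :: "trie list \<Rightarrow> nat \<Rightarrow> bool list list \<Rightarrow> trie \<Rightarrow> nat \<Rightarrow> trie list list list" where
  "mixed_search A k V m n = search (mixed_steps A k V m (outside m V) [] (take n (inside m V))) [[m], []]"

text \<open>Every line of plane 0 meets \<open>m\<close>, so the pencils at the points of
  \<open>m\<close> complete that plane. The planes with indices in \<open>is\<close> then contribute
  their pencils at the points \<open>xs\<close>.\<close>

definition plane_search ::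
  "trie list \<Rightarrow> nat \<Rightarrow> bool list list \<Rightarrow> trie \<Rightarrow> bool list list \<Rightarrow> nat list \<Rightarrow> trie list list list" where
  "plane_search A q V m xs is =
     search (pencil_steps A q m (inside m V) (outside m V) @ all_plane_steps A q V xs is) ([m] # map (\<lambda>_. []) is)"

text \<open>The part of \<open>labelling\<close> that is evaluated; \<open>set els = UNIV\<close> is
  proved separately.\<close>

definition valid_table :: "'a::field list \<Rightarrow> nat \<Rightarrow> (bool list \<times> 'a vec) list \<Rightarrow> bool" where
  "valid_table els d tb \<longleftrightarrow> distinct els \<and> map snd tb = vecs els \<and>
     distinct (map fst tb) \<and> list_all (\<lambda>p. length p = d) (map fst tb)"

definition good_planes :: "'a::field list \<Rightarrow> nat \<Rightarrow> nat \<Rightarrow> bool list list \<Rightarrow> (bool list \<times> 'a vec) list list \<Rightarrow> bool" where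
  "good_planes els d q V tbs \<longleftrightarrow> orth_tables tbs \<and>
     list_all (\<lambda>tb. valid_table els d tb \<and> set (points_of tb) = set V \<and> plane_ok q (points_of tb) (lines_of tb) (codes tb frame)) tbs"

lemma labelling_iff: "set els = UNIV \<Longrightarrow> labelling els d tb \<longleftrightarrow> valid_table els d tb"
  by (simp add: labelling_def valid_table_def)

lemma is_max_sizeI:
  fixes els :: "'a::{field, finite} list" and P :: "'b set"
  assumes P: "card P = q\<^sup>2 + q + 1" and q: "2 \<le> q" and els: "set els = UNIV" "length els = q"
    and lab: "labelling els d tb" and len: "length tb = q\<^sup>2 + q + 1"
    and planes: "good_planes els d q (points_of tb) tbs" and n: "length tbs = n"
    and upper: "\<And>S :: 'b set set set. mutually_orthogoval_PG2 q P S \<Longrightarrow> finite S \<and> card S \<le> n"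
  shows "is_max_size_orthogoval_PG2 q P n"
proof -
  have "distinct els" using lab by (simp add: labelling_def)
  then have "card (UNIV :: 'a set) = q" using els distinct_card by metis
  moreover have "card (set (points_of tb)) = card P"
    using distinct_card[OF labellingD(3)[OF lab]] len P by (simp add: points_of_def)
  moreover have "finite P" using P by (intro card_ge_0_finite) simp
  ultimately have "\<exists>S. mutually_orthogoval_PG2 q P S \<and> finite S \<and> card S = length tbs"
    using planes q by (intro orthogoval_planes_exist[where els = els and d = d and V = "set (points_of tb)"])
      (auto simp: good_planes_def list_all_iff labelling_iff[OF els(1)])
  then show ?thesis using upper n unfolding is_max_size_orthogoval_PG2_def by auto
qed

text \<open>Expresses that projectivities act transitively on the (q+1)-arcs, with \<open>m\<close>
  as the chosen representative.\<close>

definition normal_form :: "nat \<Rightarrow> (bool list \<times> 'a::{field, finite} vec) list \<Rightarrow> trie \<Rightarrow> 'b set \<Rightarrow> bool" where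
  "normal_form q tb m P \<longleftrightarrow> (\<forall>(c :: 'b \<Rightarrow> 'a vec) L l. coordinates P L c \<longrightarrow> l \<subseteq> P \<longrightarrow> card l = q + 1 \<longrightarrow>
     (\<forall>k\<in>L. card (k \<inter> l) \<le> 2) \<longrightarrow>
     (\<exists>c' :: 'b \<Rightarrow> 'a vec. coordinates P L c' \<and> (\<lambda>p. code tb (vnormalize (c' p))) ` l = pts m))"

lemma normal_form_4:
  assumes "labelling els d tb" and "cnt m m 0 = q + 1" and "q + 1 = k + 4"
    and "all_move tb m (arcs (lines_of tb) k (codes tb frame) (points_of tb)) Rs"
  shows "normal_form q tb m P"
  unfolding normal_form_def
  using four_arc_normal_form[OF assms(1) _ _ _ _ _ assms(4)] assms(2,3) by (metis card_pts)

lemma normal_form_3: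
  assumes "labelling els d tb" and "cnt m m 0 = q + 1" and "q + 1 = 3"
    and "all_move tb m (arcs (lines_of tb) 0 (codes tb (take 3 frame)) (points_of tb)) Rs"
  shows "normal_form q tb m P"
  unfolding normal_form_def
  using three_arc_normal_form[OF assms(1) _ _ _ _ _ assms(4)] assms(2,3) by (metis card_pts)

context
  fixes els :: "'a::{field, finite} list" and d q :: nat and tb and m and P :: "'b set" and S
  assumes lab: "labelling els d tb"
    and iso: "\<And>F :: nat ring. field F \<Longrightarrow> order F = q \<Longrightarrow> \<exists>h :: 'a \<Rightarrow> nat. field_iso F h"
    and nf: "normal_form q tb m P"
    and S: "mutually_orthogoval_PG2 q P S"
begin

lemma len: "p \<in> set (points_of tb) \<Longrightarrow> length p = d"
  by (rule labellingD(4)[OF lab])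

lemma card_le_of_mixed_search:
  assumes "q = Suc k" and "mixed_search (lines_of tb) k (points_of tb) m n = []"
  shows "finite S \<and> card S \<le> 2"
proof (rule card_le_of_search[OF lab iso])
  show "good_step (lines_of tb) (set (points_of tb)) q m s"
    if "s \<in> set (mixed_steps (lines_of tb) k (points_of tb) m (outside m (points_of tb)) []
      (take n (inside m (points_of tb))))" for s
  proof (rule good_mixed_steps[OF len])
    show "set (take n (inside m (points_of tb))) \<subseteq> set (points_of tb) \<inter> pts m"
      using set_take_subset set_inside by metis
    show "distinct (take n (inside m (points_of tb)) @ [])"
      using distinct_inside labellingD(3)[OF lab] by (simp add: points_of_def)
  qed (use that assms in auto)
  show "search (mixed_steps (lines_of tb) k (points_of tb) m (outside m (points_of tb)) []
      (take n (inside m (points_of tb)))) ([m] # replicate (2 - 1) []) = []"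
    using assms(2) by (simp add: mixed_search_def)
qed (use nf S index_mixed_steps in \<open>auto simp: normal_form_def\<close>)

lemma card_le_of_plane_search:
  assumes "is = [1..<n]" and "0 < n" and "set xs \<subseteq> set (points_of tb)"
    and "plane_search (lines_of tb) q (points_of tb) m xs is = []"
  shows "finite S \<and> card S \<le> n"
proof (rule card_le_of_search[OF lab iso])
  let ?ps = "pencil_steps (lines_of tb) q m (inside m (points_of tb)) (outside m (points_of tb))"
  let ?qs = "all_plane_steps (lines_of tb) q (points_of tb) xs is"
  show "good_step (lines_of tb) (set (points_of tb)) q m s" if "s \<in> set (?ps @ ?qs)" for s
  proof -
    consider "s \<in> set ?ps" | "s \<in> set ?qs" using \<open>s \<in> set (?ps @ ?qs)\<close> by auto
    then show ?thesis
    proof cases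
      case 1
      show ?thesis by (rule good_pencil_steps[OF len _ 1]) (auto simp: set_inside)
    next
      case 2
      show ?thesis by (rule good_all_plane_steps[OF len assms(3) 2])
    qed
  qed
  show "i < n" if "(i, x, ys, T) \<in> set (?ps @ ?qs)" for i x ys T
    using that assms(1,2) by (auto dest!: index_pencil_steps index_all_plane_steps)
  show "search (?ps @ ?qs) ([m] # replicate (n - 1) []) = []"
    using assms(1,4) by (simp add: plane_search_def map_replicate_const)
qed (use nf S assms(2) in \<open>auto simp: normal_form_def\<close>)

end

section \<open>Computations for q = 2, 3, 4, 5\<close>

definition els2 where "els2 = [A0, A1]"
definition tb2 where "tb2 = table els2 3"
definition m2 where "m2 = hd (arcs (lines_of tb2) 0 (codes tb2 (take 3 frame)) (points_of tb2))"
definition tbs2 where "tbs2 = tb2 # map (\<lambda>\<pi>. relabel \<pi> tb2)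
    [[0, 6, 4, 5, 2, 3, 1]]"

lemma valid2: "valid_table els2 3 tb2" by code_simp
lemma length_tb2: "length tb2 = 7" by code_simp
lemma card_m2: "cnt m2 m2 0 = 3" by code_simp
lemma planes2: "good_planes els2 3 2 (points_of tb2) tbs2" by code_simp
text \<open>The three given points already form the whole arc, so the identity matrix suffices;
  likewise for the four points in \<open>move3\<close>.\<close>

lemma move2: "all_move tb2 m2 (arcs (lines_of tb2) 0 (codes tb2 (take 3 frame)) (points_of tb2))
    [(Vec 1 0 0, Vec 0 1 0, Vec 0 0 1)]" by code_simp
text \<open>Excludes three planes: with plane 0 completed, the pencils of a third plane at four
  points are already contradictory.\<close>

lemma search2: "plane_search (lines_of tb2) 2 (points_of tb2) m2 (take 4 (points_of tb2)) [1] = []" by code_simp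

definition els3 where "els3 = [B0, B1, B2]"
definition tb3 where "tb3 = table els3 4"
definition m3 where "m3 = hd (arcs (lines_of tb3) 0 (codes tb3 frame) (points_of tb3))"
definition tbs3 where "tbs3 = tb3 # map (\<lambda>\<pi>. relabel \<pi> tb3)
    [[2, 1, 10, 12, 0, 5, 11, 4, 3, 7, 8, 6, 9],
     [2, 1, 4, 6, 0, 10, 7, 5, 3, 8, 9, 11, 12],
     [2, 1, 7, 5, 0, 9, 4, 6, 3, 12, 10, 8, 11]]"

lemma valid3: "valid_table els3 4 tb3" by code_simp
lemma length_tb3: "length tb3 = 13" by code_simp
lemma card_m3: "cnt m3 m3 0 = 4" by code_simp
lemma planes3: "good_planes els3 4 3 (points_of tb3) tbs3" by code_simp
lemma move3: "all_move tb3 m3 (arcs (lines_of tb3) 0 (codes tb3 frame) (points_of tb3))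
    [(Vec 1 0 0, Vec 0 1 0, Vec 0 0 1)]" by code_simp
text \<open>Excludes five planes: with plane 0 completed, the three others cannot even have
  compatible pencils at one point.\<close>

lemma search3: "plane_search (lines_of tb3) 3 (points_of tb3) m3 (take 1 (points_of tb3)) [1, 2, 3] = []" by code_simp

definition els4 where "els4 = [C0, C1, C2, C3]"
definition tb4 where "tb4 = table els4 5"
definition m4 where "m4 = hd (arcs (lines_of tb4) 1 (codes tb4 frame) (points_of tb4))"
definition tbs4 where "tbs4 = tb4 # map (\<lambda>\<pi>. relabel \<pi> tb4)
    [[0, 14, 17, 7, 12, 13, 9, 3, 18, 6, 19, 15, 4, 5, 1, 11, 20, 2, 8, 10, 16]]"

lemma valid4: "valid_table els4 5 tb4" by code_simp
lemma length_tb4: "length tb4 = 21" by code_simp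
lemma card_m4: "cnt m4 m4 0 = 5" by code_simp
lemma planes4: "good_planes els4 5 4 (points_of tb4) tbs4" by code_simp
text \<open>In PG(2,4) the four frame points lie in a unique hyperoval, which has two more points.
  Adding either one gives the two 5-arcs through the frame, and swapping the last two coordinates
  exchanges them.\<close>

lemma move4: "all_move tb4 m4 (arcs (lines_of tb4) 1 (codes tb4 frame) (points_of tb4))
    [(Vec 1 0 0, Vec 0 1 0, Vec 0 0 1), (Vec 1 0 0, Vec 0 0 1, Vec 0 1 0)]" by code_simp
text \<open>All five points of \<open>m4\<close> are used.\<close>

lemma search4: "mixed_search (lines_of tb4) 3 (points_of tb4) m4 5 = []" by code_simp

definition els5 where "els5 = [D0, D1, D2, D3, D4]"
definition tb5 where "tb5 = table els5 5"
definition m5 where "m5 = hd (arcs (lines_of tb5) 2 (codes tb5 frame) (points_of tb5))"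
definition tbs5 where "tbs5 = tb5 # map (\<lambda>\<pi>. relabel \<pi> tb5)
    [[0, 19, 25, 29, 6, 11, 4, 16, 12, 30, 21, 5, 8, 24, 27, 18, 7, 26, 15, 1, 23, 10, 28, 20, 13, 2, 17, 14, 22, 3, 9]]"

lemma valid5: "valid_table els5 5 tb5" by code_simp
lemma length_tb5: "length tb5 = 31" by code_simp
lemma card_m5: "cnt m5 m5 0 = 6" by code_simp
lemma planes5: "good_planes els5 5 5 (points_of tb5) tbs5" by code_simp
text \<open>The conics through the four frame points form a pencil of six, three of them degenerate.
  The remaining three are the 6-arcs through the frame, and the cyclic permutations of the
  coordinates permute them transitively.\<close>

lemma move5: "all_move tb5 m5 (arcs (lines_of tb5) 2 (codes tb5 frame) (points_of tb5))
    [(Vec 1 0 0, Vec 0 1 0, Vec 0 0 1), (Vec 0 1 0, Vec 0 0 1, Vec 1 0 0), (Vec 0 0 1, Vec 1 0 0, Vec 0 1 0)]" by code_simp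
text \<open>Four of the six points of \<open>m5\<close> already lead to a contradiction.\<close>

lemma search5: "mixed_search (lines_of tb5) 4 (points_of tb5) m5 4 = []" by code_simp

lemma labelling_tables:
  "labelling els2 3 tb2" "labelling els3 4 tb3" "labelling els4 5 tb4" "labelling els5 5 tb5"
  using valid2 valid3 valid4 valid5
  by (auto simp: labelling_iff els2_def els3_def els4_def els5_def UNIV_gf2 UNIV_gf3 UNIV_gf4 UNIV_gf5)

theorem theorem2p3:
  fixes P :: "'a set" and q :: nat
  assumes "card P = q\<^sup>2 + q + 1"
  shows "(q \<in> {2, 4, 5} \<longrightarrow> is_max_size_orthogoval_PG2 q P 2) \<and>
         (q = 3 \<longrightarrow> is_max_size_orthogoval_PG2 q P 4)"
proof -
  have "is_max_size_orthogoval_PG2 2 P 2" if "q = 2"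
  proof (rule is_max_sizeI[OF _ _ _ _ labelling_tables(1) _ planes2])
    show "finite S \<and> card S \<le> 2" if "mutually_orthogoval_PG2 2 P S" for S
      by (rule card_le_of_plane_search[OF labelling_tables(1) gf2_iso
            normal_form_3[OF labelling_tables(1) _ _ move2] that _ _ _ search2])
        (auto simp: card_m2 upt_rec dest: in_set_takeD)
  qed (use assms that in \<open>simp_all add: els2_def UNIV_gf2 length_tb2 tbs2_def\<close>)
  moreover have "is_max_size_orthogoval_PG2 3 P 4" if "q = 3"
  proof (rule is_max_sizeI[OF _ _ _ _ labelling_tables(2) _ planes3])
    show "finite S \<and> card S \<le> 4" if "mutually_orthogoval_PG2 3 P S" for S
      by (rule card_le_of_plane_search[OF labelling_tables(2) gf3_iso
            normal_form_4[OF labelling_tables(2) _ _ move3] that _ _ _ search3])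
        (auto simp: card_m3 upt_rec dest: in_set_takeD)
  qed (use assms that in \<open>simp_all add: els3_def UNIV_gf3 length_tb3 tbs3_def\<close>)
  moreover have "is_max_size_orthogoval_PG2 4 P 2" if "q = 4"
  proof (rule is_max_sizeI[OF _ _ _ _ labelling_tables(3) _ planes4])
    show "finite S \<and> card S \<le> 2" if "mutually_orthogoval_PG2 4 P S" for S
      by (rule card_le_of_mixed_search[OF labelling_tables(3) gf4_iso
            normal_form_4[OF labelling_tables(3) _ _ move4] that _ search4])
        (simp_all add: card_m4)
  qed (use assms that in \<open>simp_all add: els4_def UNIV_gf4 length_tb4 tbs4_def\<close>)
  moreover have "is_max_size_orthogoval_PG2 5 P 2" if "q = 5"
  proof (rule is_max_sizeI[OF _ _ _ _ labelling_tables(4) _ planes5])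
    show "finite S \<and> card S \<le> 2" if "mutually_orthogoval_PG2 5 P S" for S
      by (rule card_le_of_mixed_search[OF labelling_tables(4) gf5_iso
            normal_form_4[OF labelling_tables(4) _ _ move5] that _ search5])
        (simp_all add: card_m5)
  qed (use assms that in \<open>simp_all add: els5_def UNIV_gf5 length_tb5 tbs5_def\<close>)
  ultimately show ?thesis by auto
qed

end
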